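(* There is an absolute constant $C>0$ such that the following holds. Let $n\ge 1$ and let $f:\{0,1\}^n\to\{0,1\}$ be any boolean function. Define the $4$-argument XOR function $F:(\{0,1\}^n)^4\to\{0,1\}$ by $F(x_1,x_2,x_3,x_4)=f(x_1\oplus x_2\oplus x_3\oplus x_4)$, where $\oplus$ is bitwise XOR. Then \[\mathrm{PDT}(f)\le C\cdot \mathrm{CC}_4(F)^5 .\]
   Context: A parity decision tree (PDT) for $f$ is a rooted tree whose internal nodes are labelled by subsets $S\subseteq[n]$ and whose leaves are labelled by values in $\{0,1\}$; on input $x$ one starts at the root, at each internal node queries the parity $\sum_{i\in S}x_i \bmod 2$ and follows the branch given by the answer, and outputs the label of the leaf reached. $\mathrm{PDT}(f)$ is the minimum, over PDTs computing $f$ correctly on all inputs, of the maximum number of queries made on any input (the depth). $\mathrm{CC}_4(F)$ is the deterministic number-in-hand multiparty communication complexity of $F$ in the blackboard model: there are $4$ players, player $P_i$ receives $x_i\in\{0,1\}^n$, every message is written on a blackboard visible to all players, and $\mathrm{CC}_4(F)$ is the least number of bits that must be communicated in the worst case by a deterministic protocol that computes $F$ correctly on all inputs. *)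

theory Defs
  imports Complex_Main
begin

definition cube :: "nat \<Rightarrow> bool list set" where
  "cube n = {x. length x = n}"

definition bxor :: "bool list \<Rightarrow> bool list \<Rightarrow> bool list" where
  "bxor x y = map2 (\<noteq>) x y"

definition parity :: "nat set \<Rightarrow> bool list \<Rightarrow> bool" where
  "parity S x = odd (card {i \<in> S. i < length x \<and> x ! i})"

datatype pdt = PLeaf bool | PNode "nat set" pdt pdt

fun pdt_eval :: "pdt \<Rightarrow> bool list \<Rightarrow> bool" where
  "pdt_eval (PLeaf b) x = b"
| "pdt_eval (PNode S t0 t1) x = (if parity S x then pdt_eval t1 x else pdt_eval t0 x)"

fun pdt_depth :: "pdt \<Rightarrow> nat" where
  "pdt_depth (PLeaf b) = 0"
| "pdt_depth (PNode S t0 t1) = Suc (max (pdt_depth t0) (pdt_depth t1))"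

fun pdt_wf :: "nat \<Rightarrow> pdt \<Rightarrow> bool" where
  "pdt_wf n (PLeaf b) = True"
| "pdt_wf n (PNode S t0 t1) = (S \<subseteq> {..<n} \<and> pdt_wf n t0 \<and> pdt_wf n t1)"

definition pdt_computes :: "nat \<Rightarrow> pdt \<Rightarrow> (bool list \<Rightarrow> bool) \<Rightarrow> bool" where
  "pdt_computes n T f \<longleftrightarrow> pdt_wf n T \<and> (\<forall>x\<in>cube n. pdt_eval T x = f x)"

definition PDT :: "nat \<Rightarrow> (bool list \<Rightarrow> bool) \<Rightarrow> nat" where
  "PDT n f = (LEAST d. \<exists>T. pdt_computes n T f \<and> pdt_depth T = d)"

text \<open>A protocol tree: at an internal node, player i writes one bit g(x_i) on the
  blackboard, which depends only on its own input (the history is encoded by the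
  position in the tree); bit 0 leads to the left subtree, bit 1 to the right.
  Leaves are labelled by the output.\<close>

datatype proto = Out bool | Speak nat "bool list \<Rightarrow> bool" proto proto

fun proto_eval :: "proto \<Rightarrow> (nat \<Rightarrow> bool list) \<Rightarrow> bool" where
  "proto_eval (Out b) xs = b"
| "proto_eval (Speak i g p0 p1) xs = (if g (xs i) then proto_eval p1 xs else proto_eval p0 xs)"

fun proto_cost :: "proto \<Rightarrow> nat" where
  "proto_cost (Out b) = 0"
| "proto_cost (Speak i g p0 p1) = Suc (max (proto_cost p0) (proto_cost p1))"

fun proto_wf :: "nat \<Rightarrow> proto \<Rightarrow> bool" where
  "proto_wf k (Out b) = True"
| "proto_wf k (Speak i g p0 p1) = (i < k \<and> proto_wf k p0 \<and> proto_wf k p1)"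

definition proto_computes ::
  "nat \<Rightarrow> nat \<Rightarrow> proto \<Rightarrow> ((nat \<Rightarrow> bool list) \<Rightarrow> bool) \<Rightarrow> bool" where
  "proto_computes k n P F \<longleftrightarrow> proto_wf k P \<and>
     (\<forall>xs. (\<forall>i<k. xs i \<in> cube n) \<longrightarrow> proto_eval P xs = F xs)"

definition CC :: "nat \<Rightarrow> nat \<Rightarrow> ((nat \<Rightarrow> bool list) \<Rightarrow> bool) \<Rightarrow> nat" where
  "CC k n F = (LEAST c. \<exists>P. proto_computes k n P F \<and> proto_cost P = c)"

end

theory Submission
  imports Defs "HOL-Library.FuncSet"
begin

text \<open>
  A protocol of cost \<open>c\<close> yields a monochromatic box of density \<open>2\<^sup>-\<^sup>c\<close>; intersecting suitable
  translates of its sides gives one set \<open>B\<close> of density \<open>2\<^sup>-\<^sup>c\<close> such that \<open>f\<close> is constant on a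
  translate of \<open>4B\<close>. By Sanders' quasi-polynomial Bogolyubov theorem (Croot--Sisask
  almost-periodicity combined with Chang's theorem), \<open>4B\<close> contains a subspace \<open>V\<close> of codimension
  \<open>O(c\<^sup>4)\<close>. Since \<open>f\<close> is constant on a coset of \<open>V\<close>, the nontrivial Fourier coefficients of \<open>f\<close>
  cancel within each coset of the annihilator of \<open>V\<close>, so each such coset contains either none or
  at least two of them; hence querying \<open>O(c\<^sup>4)\<close> parities to learn the coset of \<open>V\<close> halves the
  number of nontrivial coefficients. That number is at most the rank of \<open>f(x \<oplus> y)\<close>, which is at
  most \<open>2\<^sup>c\<close>, so \<open>c + 1\<close> rounds suffice.
\<close>

section \<open>Fourier analysis on elementary abelian 2-groups\<close>

text \<open>The exponent 4 of the codimension arises as follows. Parseval costs a factor 2^c, so the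
  number t of smoothing steps is of order c; t sampling errors must add up to a small constant, so
  \<epsilon> is of order 1 / t; and the exceptional set must stay small next to B, so the sample
  size k is of order t / \<epsilon>^2. The almost-periods then have density about 2^(-c * k), which
  Chang's theorem turns into c * t^3 parities. Restricting f does not lower c, so progress is
  measured by the spectrum alone; this is why both a box in every restriction and a bound on the
  initial spectrum are extracted from the protocol. Every restriction is pulled back through a
  projection to a function on the whole group, so the induction never changes the group.\<close>

text \<open>A finite group of exponent 2, identified with its dual group by a symmetric nondegenerate
  pairing: \<open>chi u\<close> is the character belonging to \<open>u\<close>.\<close>

locale self_dual_2group =
  fixes G :: "'a set"
    and add :: "'a \<Rightarrow> 'a \<Rightarrow> 'a" (infixl "\<oplus>" 65)
    and zero :: 'a ("\<zero>")
    and chi :: "'a \<Rightarrow> 'a \<Rightarrow> real"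
  assumes fin [simp]: "finite G"
    and zero_closed [simp]: "\<zero> \<in> G"
    and add_closed [simp]: "\<lbrakk>x \<in> G; y \<in> G\<rbrakk> \<Longrightarrow> x \<oplus> y \<in> G"
    and g_assoc: "\<lbrakk>x \<in> G; y \<in> G; z \<in> G\<rbrakk> \<Longrightarrow> (x \<oplus> y) \<oplus> z = x \<oplus> (y \<oplus> z)"
    and g_commute: "\<lbrakk>x \<in> G; y \<in> G\<rbrakk> \<Longrightarrow> x \<oplus> y = y \<oplus> x"
    and zero_add [simp]: "x \<in> G \<Longrightarrow> \<zero> \<oplus> x = x"
    and add_self [simp]: "x \<in> G \<Longrightarrow> x \<oplus> x = \<zero>"
    and chi_cases: "\<lbrakk>u \<in> G; x \<in> G\<rbrakk> \<Longrightarrow> chi u x = 1 \<or> chi u x = -1"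
    and chi_add: "\<lbrakk>u \<in> G; x \<in> G; y \<in> G\<rbrakk> \<Longrightarrow> chi u (x \<oplus> y) = chi u x * chi u y"
    and chi_sym: "\<lbrakk>u \<in> G; x \<in> G\<rbrakk> \<Longrightarrow> chi u x = chi x u"
    and chi_nondegenerate: "\<lbrakk>x \<in> G; \<And>u. u \<in> G \<Longrightarrow> chi u x = 1\<rbrakk> \<Longrightarrow> x = \<zero>"
begin

lemma g_left_commute: "\<lbrakk>x \<in> G; y \<in> G; z \<in> G\<rbrakk> \<Longrightarrow> x \<oplus> (y \<oplus> z) = y \<oplus> (x \<oplus> z)"
  by (metis g_assoc g_commute)

lemmas g_ac = g_assoc g_commute g_left_commute

lemma add_zero [simp]: "x \<in> G \<Longrightarrow> x \<oplus> \<zero> = x"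
  by (metis g_commute zero_add zero_closed)

lemma add_cancel [simp]:
  assumes "x \<in> G" "a \<in> G"
  shows "x \<oplus> a \<oplus> a = x" "a \<oplus> (a \<oplus> x) = x"
  using assms by (simp_all add: g_assoc) (metis add_self g_assoc zero_add)

lemma add_eq_zero_iff: "\<lbrakk>x \<in> G; y \<in> G\<rbrakk> \<Longrightarrow> x \<oplus> y = \<zero> \<longleftrightarrow> x = y"
  by (metis add_cancel(1) add_self zero_add)

lemma card_pos [simp]: "0 < card G"
  using card_gt_0_iff fin zero_closed by blast

lemma chi_zero [simp]: "u \<in> G \<Longrightarrow> chi u \<zero> = 1"
  by (metis add_self chi_add chi_cases mult_1 mult_minus1 minus_minus zero_closed)

lemma chi_add_left: "\<lbrakk>u \<in> G; w \<in> G; x \<in> G\<rbrakk> \<Longrightarrow> chi (u \<oplus> w) x = chi u x * chi w x"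
  by (simp add: chi_sym[of _ x] chi_add)

lemma abs_chi [simp]: "\<lbrakk>u \<in> G; x \<in> G\<rbrakk> \<Longrightarrow> \<bar>chi u x\<bar> = 1"
  using chi_cases by fastforce

lemma bij_shift: "a \<in> G \<Longrightarrow> bij_betw (\<lambda>x. x \<oplus> a) G G"
  by (rule bij_betw_byWitness[where f' = "\<lambda>x. x \<oplus> a"]) auto

lemma sum_shift: "a \<in> G \<Longrightarrow> (\<Sum>x\<in>G. \<phi> (x \<oplus> a)) = (\<Sum>x\<in>G. \<phi> x)"
  by (rule sum.reindex_bij_betw[OF bij_shift])

lemma sum_chi:
  assumes "x \<in> G"
  shows "(\<Sum>u\<in>G. chi u x) = (if x = \<zero> then real (card G) else 0)"
proof (cases "x = \<zero>")
  case False
  then obtain w where w: "w \<in> G" "chi w x = -1"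
    using chi_nondegenerate chi_cases assms by metis
  have "(\<Sum>u\<in>G. chi u x) = (\<Sum>u\<in>G. chi (u \<oplus> w) x)"
    using sum_shift[OF w(1), of "\<lambda>u. chi u x"] by simp
  also have "\<dots> = - (\<Sum>u\<in>G. chi u x)"
    using w assms by (simp add: chi_add_left sum_negf)
  finally show ?thesis using False by simp
qed simp

lemma sum_chi_mult:
  assumes "x \<in> G" "y \<in> G"
  shows "(\<Sum>u\<in>G. chi u x * chi u y) = (if x = y then real (card G) else 0)"
  using sum_chi[of "x \<oplus> y"] assms by (simp add: chi_add add_eq_zero_iff)

definition fourier :: "('a \<Rightarrow> real) \<Rightarrow> 'a \<Rightarrow> real" where
  "fourier f u = (\<Sum>x\<in>G. f x * chi u x) / card G"

lemma fourier_inversion: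
  assumes "y \<in> G"
  shows "f y = (\<Sum>u\<in>G. fourier f u * chi u y)"
proof -
  have "(\<Sum>u\<in>G. fourier f u * chi u y) = (\<Sum>u\<in>G. \<Sum>x\<in>G. f x / card G * (chi u x * chi u y))"
    by (simp add: fourier_def sum_divide_distrib sum_distrib_left sum_distrib_right mult_ac)
  also have "\<dots> = (\<Sum>x\<in>G. \<Sum>u\<in>G. f x / card G * (chi u x * chi u y))"
    by (rule sum.swap)
  also have "\<dots> = (\<Sum>x\<in>G. f x / card G * (if x = y then real (card G) else 0))"
    using assms by (simp only: sum_distrib_left[symmetric] sum_chi_mult cong: sum.cong)
  also have "\<dots> = (\<Sum>x\<in>G. if x = y then f x else 0)"
    by (rule sum.cong) (auto simp: card_gt_0_iff[symmetric])
  also have "\<dots> = f y" using assms by simp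
  finally show ?thesis by simp
qed

lemma fourier_unique:
  assumes "w \<in> G" and f: "\<And>x. x \<in> G \<Longrightarrow> f x = (\<Sum>u\<in>G. c u * chi u x)"
  shows "fourier f w = c w"
proof -
  have "(\<Sum>x\<in>G. f x * chi w x) = (\<Sum>x\<in>G. \<Sum>u\<in>G. c u * (chi x u * chi x w))"
    using assms(1) by (simp add: f sum_distrib_left sum_distrib_right mult_ac chi_sym)
  also have "\<dots> = (\<Sum>u\<in>G. \<Sum>x\<in>G. c u * (chi x u * chi x w))"
    by (rule sum.swap)
  also have "\<dots> = (\<Sum>u\<in>G. c u * (if u = w then real (card G) else 0))"
    using assms(1) by (simp add: sum_distrib_left[symmetric] sum_chi_mult)
  also have "\<dots> = (\<Sum>u\<in>G. if u = w then c u * card G else 0)"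
    by (rule sum.cong) auto
  also have "\<dots> = c w * card G" using assms(1) by simp
  finally show ?thesis using assms(1) by (auto simp: fourier_def)
qed

lemma abs_fourier_le:
  assumes "u \<in> G" "\<And>x. x \<in> G \<Longrightarrow> \<bar>f x\<bar> \<le> 1"
  shows "\<bar>fourier f u\<bar> \<le> 1"
proof -
  have "\<bar>\<Sum>x\<in>G. f x * chi u x\<bar> \<le> (\<Sum>x\<in>G. \<bar>f x * chi u x\<bar>)" by (rule sum_abs)
  also have "\<dots> \<le> (\<Sum>x\<in>G. 1)" using assms by (intro sum_mono) (simp add: abs_mult)
  finally show ?thesis by (simp add: fourier_def divide_le_eq)
qed

text \<open>Convolution with the uniform probability measure on \<open>X\<close>; signs do not
  matter since x = -x. \<open>mean_chi X\<close> is the Fourier transform of that measure, so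
  \<open>av X\<close> multiplies the coefficient at \<open>u\<close> by
  \<open>mean_chi X u\<close>.\<close>

definition av :: "'a set \<Rightarrow> ('a \<Rightarrow> real) \<Rightarrow> 'a \<Rightarrow> real" where
  "av X f y = (\<Sum>x\<in>X. f (y \<oplus> x)) / card X"

definition mean_chi :: "'a set \<Rightarrow> 'a \<Rightarrow> real" where
  "mean_chi X u = (\<Sum>x\<in>X. chi u x) / card X"

lemma av_chi_expansion:
  assumes "X \<subseteq> G" "y \<in> G" and f: "\<And>x. x \<in> G \<Longrightarrow> f x = (\<Sum>u\<in>G. c u * chi u x)"
  shows "av X f y = (\<Sum>u\<in>G. (c u * mean_chi X u) * chi u y)"
proof -
  have "av X f y = (\<Sum>x\<in>X. \<Sum>u\<in>G. c u * chi u y * chi u x) / card X"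
    unfolding av_def
    by (intro arg_cong2[where f = "(/)"] sum.cong refl, subst f)
       (use assms(1,2) in \<open>auto simp: chi_add mult_ac intro!: sum.cong\<close>)
  also have "(\<Sum>x\<in>X. \<Sum>u\<in>G. c u * chi u y * chi u x) = (\<Sum>u\<in>G. \<Sum>x\<in>X. c u * chi u y * chi u x)"
    by (rule sum.swap)
  finally show ?thesis
    by (simp add: mean_chi_def sum_distrib_left sum_distrib_right sum_divide_distrib mult_ac)
qed

lemma av_pow_chi_expansion:
  assumes "X \<subseteq> G" "y \<in> G" and "\<And>x. x \<in> G \<Longrightarrow> f x = (\<Sum>u\<in>G. c u * chi u x)"
  shows "(av X ^^ t) f y = (\<Sum>u\<in>G. (c u * mean_chi X u ^ t) * chi u y)"
  using assms(2)
proof (induction t arbitrary: y)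
  case 0
  then show ?case using assms(3) by simp
next
  case (Suc t)
  have "av X ((av X ^^ t) f) y = (\<Sum>u\<in>G. (c u * mean_chi X u ^ t * mean_chi X u) * chi u y)"
    by (rule av_chi_expansion[OF assms(1) Suc.prems]) (rule Suc.IH)
  then show ?case by (simp add: mult_ac)
qed

lemma sum_mean_chi_sq:
  assumes "A \<subseteq> G" "A \<noteq> {}"
  shows "(\<Sum>u\<in>G. (mean_chi A u)\<^sup>2) = card G / card A"
proof -
  have fA: "finite A" using assms finite_subset fin by blast
  have cA: "card A > 0" using fA assms by (simp add: card_gt_0_iff)
  have "(\<Sum>u\<in>G. (\<Sum>x\<in>A. chi u x)\<^sup>2) = (\<Sum>u\<in>G. \<Sum>x\<in>A. \<Sum>y\<in>A. chi u x * chi u y)"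
    by (simp add: power2_eq_square sum_product)
  also have "\<dots> = (\<Sum>x\<in>A. \<Sum>u\<in>G. \<Sum>y\<in>A. chi u x * chi u y)" by (rule sum.swap)
  also have "\<dots> = (\<Sum>x\<in>A. \<Sum>y\<in>A. \<Sum>u\<in>G. chi u x * chi u y)"
    by (rule sum.cong[OF refl]) (rule sum.swap)
  also have "\<dots> = (\<Sum>x\<in>A. \<Sum>y\<in>A. if x = y then real (card G) else 0)"
    using assms by (intro sum.cong refl) (simp add: sum_chi_mult subset_iff)
  also have "\<dots> = real (card A) * card G" using fA by simp
  finally show ?thesis using cA
    by (simp add: mean_chi_def power_divide sum_divide_distrib[symmetric] power2_eq_square)
qed

lemma abs_av_le:
  assumes "X \<subseteq> G" "X \<noteq> {}" "y \<in> G" "\<And>x. x \<in> G \<Longrightarrow> \<bar>f x\<bar> \<le> c"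
  shows "\<bar>av X f y\<bar> \<le> c"
proof -
  have fX: "finite X" using assms finite_subset fin by blast
  have "\<bar>\<Sum>x\<in>X. f (y \<oplus> x)\<bar> \<le> (\<Sum>x\<in>X. \<bar>f (y \<oplus> x)\<bar>)" by (rule sum_abs)
  also have "\<dots> \<le> (\<Sum>x\<in>X. c)" using assms by (intro sum_mono) (auto simp: subset_iff)
  finally show ?thesis using fX assms(2) by (simp add: av_def card_gt_0_iff divide_le_eq mult.commute)
qed

lemma av_diff: "av X (\<lambda>x. f x - g x) y = av X f y - av X g y"
  by (simp add: av_def sum_subtractf diff_divide_distrib)

text \<open>\<open>av X\<close> is a contraction in the supremum norm, so each further averaging
  adds at most one more error \<delta>.\<close>

lemma av_pow_close:
  assumes X: "X \<subseteq> G" "X \<noteq> {}" and "y \<in> G"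
    and f: "\<And>x y. \<lbrakk>x \<in> X; y \<in> G\<rbrakk> \<Longrightarrow> \<bar>f (y \<oplus> x) - f y\<bar> \<le> \<delta>"
  shows "\<bar>(av X ^^ t) f y - f y\<bar> \<le> t * \<delta>"
  using assms(3)
proof (induction t arbitrary: y)
  case (Suc t)
  have fX: "finite X" using X finite_subset fin by blast
  have cX: "card X > 0" using fX X by (simp add: card_gt_0_iff)
  have "\<bar>av X (\<lambda>x. (av X ^^ t) f x - f x) y\<bar> \<le> t * \<delta>"
    by (rule abs_av_le[OF X Suc.prems Suc.IH])
  then have 1: "\<bar>(av X ^^ Suc t) f y - av X f y\<bar> \<le> t * \<delta>" by (simp add: av_diff)
  have "av X f y - f y = (\<Sum>x\<in>X. f (y \<oplus> x) - f y) / card X"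
    using cX by (simp add: av_def sum_subtractf diff_divide_distrib)
  moreover have "\<bar>\<Sum>x\<in>X. f (y \<oplus> x) - f y\<bar> \<le> (\<Sum>x\<in>X. \<bar>f (y \<oplus> x) - f y\<bar>)" by (rule sum_abs)
  moreover have "\<dots> \<le> (\<Sum>x\<in>X. \<delta>)" by (intro sum_mono f Suc.prems)
  ultimately have "\<bar>av X f y - f y\<bar> \<le> \<delta>"
    using cX by (auto simp: divide_le_eq mult.commute intro: order_trans)
  then show ?case using 1 by (simp add: algebra_simps)
qed simp

lemma av_nonneg_le_one:
  assumes A: "A \<subseteq> G" "A \<noteq> {}" and s: "\<And>x. x \<in> G \<Longrightarrow> 0 \<le> s x \<and> s x \<le> 1" and y: "y \<in> G"
  shows "0 \<le> av A s y \<and> av A s y \<le> 1"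
proof -
  have fA: "finite A" using A finite_subset fin by blast
  have cA: "card A > 0" using fA A by (simp add: card_gt_0_iff)
  have "s (y \<oplus> a) \<ge> 0 \<and> s (y \<oplus> a) \<le> 1" if "a \<in> A" for a using s y that A by auto
  then have "0 \<le> (\<Sum>a\<in>A. s (y \<oplus> a))" "(\<Sum>a\<in>A. s (y \<oplus> a)) \<le> of_nat (card A) * 1"
    by (blast intro: sum_nonneg, blast intro: sum_bounded_above)
  then show ?thesis using cA by (simp add: av_def divide_le_eq)
qed

end

section \<open>Chang's theorem\<close>

lemma ln_two_point: "b = 1 \<or> b = -1 \<Longrightarrow>
    ln (1 + b / 2) = (ln (3/4) + b * ln 3) / (2::real)"
  by (auto simp: ln_div ln_mult field_simps ln_realpow[of 2 2, simplified])

context self_dual_2group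
begin

text \<open>The witnesses \<open>e\<close> make the characters \<open>u\<close> independent and also serve as coset
  representatives in \<open>proj\<close> below. The head of the list is the character that was added last.\<close>

fun triangular :: "('a \<times> 'a) list \<Rightarrow> bool" where
  "triangular [] = True"
| "triangular ((u, e) # L) \<longleftrightarrow>
     triangular L \<and> u \<in> G \<and> e \<in> G \<and> (\<forall>p\<in>set L. chi (fst p) e = 1) \<and> chi u e = -1"

definition annihilator :: "('a \<times> 'a) list \<Rightarrow> 'a set" where
  "annihilator L = {x \<in> G. \<forall>p\<in>set L. chi (fst p) x = 1}"

lemma triangular_closed: "\<lbrakk>triangular L; p \<in> set L\<rbrakk> \<Longrightarrow> fst p \<in> G \<and> snd p \<in> G"
  by (induction L rule: triangular.induct) auto

lemma sum_chi_mult_invariant: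
  assumes "u \<in> G" "e \<in> G" "chi u e = -1" "\<And>x. x \<in> G \<Longrightarrow> F (x \<oplus> e) = F x"
  shows "(\<Sum>x\<in>G. F x * chi u x) = 0"
proof -
  have "(\<Sum>x\<in>G. F x * chi u x) = (\<Sum>x\<in>G. F (x \<oplus> e) * chi u (x \<oplus> e))"
    using sum_shift[OF assms(2), of "\<lambda>x. F x * chi u x"] by simp
  also have "\<dots> = - (\<Sum>x\<in>G. F x * chi u x)"
    using assms by (simp add: chi_add sum_negf)
  finally show ?thesis by simp
qed

text \<open>The Riesz product of the listed characters. With every \<open>s u\<close> equal to 1/2
  or -1/2 and a triangular list it is positive with mean 1: a probability density leaning towards
  prescribed signs of the characters.\<close>

definition riesz :: "('a \<Rightarrow> real) \<Rightarrow> ('a \<times> 'a) list \<Rightarrow> 'a \<Rightarrow> real" where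
  "riesz s L x = (\<Prod>p\<leftarrow>L. 1 + s (fst p) * chi (fst p) x)"

lemma riesz_invariant:
  assumes "triangular L" "e \<in> G" "x \<in> G" "\<forall>p\<in>set L. chi (fst p) e = 1"
  shows "riesz s L (x \<oplus> e) = riesz s L x"
  using assms(4) triangular_closed[OF assms(1)]
  by (induction L) (auto simp: riesz_def chi_add assms(2,3))

text \<open>The term of the head character vanishes: its witness \<open>e\<close> flips
  \<open>chi u\<close> and leaves every factor of the tail fixed.\<close>

lemma sum_riesz: "triangular L \<Longrightarrow> (\<Sum>x\<in>G. riesz s L x) = card G"
proof (induction L rule: triangular.induct)
  case (2 u e L)
  then have t: "triangular L" "u \<in> G" "e \<in> G" "\<forall>p\<in>set L. chi (fst p) e = 1" "chi u e = -1"
    by auto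
  have "(\<Sum>x\<in>G. riesz s ((u, e) # L) x)
      = (\<Sum>x\<in>G. riesz s L x) + s u * (\<Sum>x\<in>G. riesz s L x * chi u x)"
    by (simp add: riesz_def algebra_simps sum.distrib sum_distrib_left)
  also have "(\<Sum>x\<in>G. riesz s L x * chi u x) = 0"
    using t by (intro sum_chi_mult_invariant[of u e] riesz_invariant) auto
  finally show ?case using 2 t by simp
qed (simp add: riesz_def)

lemma riesz_pos:
  assumes "triangular L" "x \<in> G" "\<And>u. \<bar>s u\<bar> = 1/2"
  shows "0 < riesz s L x"
  using assms(1)
proof (induction L rule: triangular.induct)
  case (2 u e L)
  have "\<bar>s u * chi u x\<bar> = 1/2" using 2 assms by (simp add: abs_mult)
  then have "0 < 1 + s u * chi u x" by linarith
  then show ?case using 2 by (simp add: riesz_def)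
qed (simp add: riesz_def)

text \<open>The factor \<open>1 + b / 2\<close> with \<open>b = \<plusminus>1\<close> has a logarithm that is affine in \<open>b\<close>, so the mean of
  \<open>ln riesz\<close> over \<open>X\<close> is computed from the Fourier coefficients of \<open>X\<close> alone.\<close>

lemma sum_ln_riesz_ge:
  assumes "triangular L" "X \<subseteq> G" "X \<noteq> {}"
    and spec: "\<forall>p\<in>set L. 1/2 \<le> \<bar>mean_chi X (fst p)\<bar>"
    and s: "\<And>u. s u = (if 0 \<le> mean_chi X u then 1/2 else -1/2)"
  shows "length L * (card X * (ln (27/16) / 4)) \<le> (\<Sum>x\<in>X. ln (riesz s L x))"
  using assms(1) spec
proof (induction L rule: triangular.induct)
  case (2 u e L)
  have fX: "finite X" using assms finite_subset fin by blast
  have cX: "card X > 0" using fX assms by (simp add: card_gt_0_iff)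
  have u: "u \<in> G" using 2 by simp
  have s2: "\<bar>s v\<bar> = 1/2" for v by (simp add: s)
  have step: "ln (riesz s ((u, e) # L) x) = ln (3/4) / 2 + s u * ln 3 * chi u x + ln (riesz s L x)"
    if "x \<in> X" for x
  proof -
    have xG: "x \<in> G" using that assms by auto
    have "2 * s u * chi u x = 1 \<or> 2 * s u * chi u x = -1"
      using chi_cases[OF u xG] by (auto simp: s)
    then have "ln (1 + s u * chi u x) = (ln (3/4) + (2 * s u * chi u x) * ln 3) / 2"
      using ln_two_point[of "2 * s u * chi u x"] by simp
    moreover have "0 < riesz s L x" using riesz_pos xG s2 2 by auto
    moreover have "0 < 1 + s u * chi u x"
      using chi_cases[OF u xG] by (auto simp: s)
    ultimately show ?thesis by (simp add: riesz_def ln_mult add_divide_distrib)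
  qed
  \<comment> \<open>A spectral value of modulus at least 1/2 contributes on average at least ln
    (3/4) / 2 + ln 3 / 4. By (3/4)^2 * 3 = 27/16 this is ln (27/16) / 4, which is positive.\<close>
  have "s u * mean_chi X u \<ge> 1/4" using 2 by (auto simp: s)
  then have "s u * mean_chi X u * ln 3 \<ge> 1/4 * ln 3" by (intro mult_right_mono) auto
  moreover have "ln (27/16) / 4 = ln (3/4) / 2 + 1/4 * ln (3::real)"
    using ln_realpow[of 3 3] ln_realpow[of 2 4] ln_realpow[of 2 2] by (simp add: ln_div)
  ultimately have k: "ln (27/16) / 4 \<le> ln (3/4) / 2 + s u * ln 3 * mean_chi X u"
    by (simp add: mult_ac)
  have "(\<Sum>x\<in>X. ln (riesz s ((u, e) # L) x))
      = card X * (ln (3/4) / 2) + s u * ln 3 * (\<Sum>x\<in>X. chi u x) + (\<Sum>x\<in>X. ln (riesz s L x))"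
    by (simp add: step sum.distrib sum_distrib_left)
  also have "(\<Sum>x\<in>X. chi u x) = card X * mean_chi X u" using cX by (simp add: mean_chi_def)
  also have "card X * (ln (3/4) / 2) + s u * ln 3 * (card X * mean_chi X u)
      = card X * (ln (3/4) / 2 + s u * ln 3 * mean_chi X u)"
    by (simp add: algebra_simps)
  also have "\<dots> + (\<Sum>x\<in>X. ln (riesz s L x))
      \<ge> card X * (ln (27/16) / 4) + length L * (card X * (ln (27/16) / 4))"
    using 2 by (intro add_mono mult_left_mono k) auto
  finally show ?case by (simp add: algebra_simps)
qed (simp add: riesz_def)

text \<open>Jensen's inequality: the mean of \<open>ln riesz\<close> over \<open>X\<close> is at most the logarithm of the mean of
  \<open>riesz\<close>, and the latter is at most \<open>card G / card X\<close> because \<open>riesz\<close> has mean 1 over \<open>G\<close>.\<close>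

lemma chang_length_bound:
  assumes L: "triangular L" and X: "X \<subseteq> G" "X \<noteq> {}"
    and spec: "\<forall>p\<in>set L. 1/2 \<le> \<bar>mean_chi X (fst p)\<bar>"
  shows "length L * (ln (27/16) / 4) \<le> ln (card G / card X)"
proof -
  have fX: "finite X" using X finite_subset fin by blast
  have cX: "card X > 0" using fX X by (simp add: card_gt_0_iff)
  define s :: "'a \<Rightarrow> real" where "s u = (if 0 \<le> mean_chi X u then 1/2 else -1/2)" for u
  have pos: "0 < riesz s L x" if "x \<in> G" for x
    using riesz_pos[OF L that] by (simp add: s_def)
  define R where "R = real (card G) / card X"
  have R: "R > 0" using cX by (simp add: R_def)
  have "length L * (card X * (ln (27/16) / 4)) \<le> (\<Sum>x\<in>X. ln (riesz s L x))"
    by (rule sum_ln_riesz_ge[OF L X spec]) (simp add: s_def)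
  also have "\<dots> \<le> (\<Sum>x\<in>X. ln R + (riesz s L x / R - 1))"
  proof (rule sum_mono)
    fix x assume "x \<in> X"
    then have "0 < riesz s L x" using pos X by auto
    then show "ln (riesz s L x) \<le> ln R + (riesz s L x / R - 1)"
      using ln_le_minus_one[of "riesz s L x / R"] R by (simp add: ln_div)
  qed
  also have "\<dots> = card X * ln R + (\<Sum>x\<in>X. riesz s L x) / R - card X"
    by (simp add: sum.distrib sum_subtractf sum_divide_distrib)
  also have "(\<Sum>x\<in>X. riesz s L x) \<le> (\<Sum>x\<in>G. riesz s L x)"
    using X pos by (intro sum_mono2) (auto intro: less_imp_le)
  also have "(\<Sum>x\<in>G. riesz s L x) = R * card X"
    using sum_riesz[OF L] cX by (simp add: R_def)
  finally have "card X * (length L * (ln (27/16) / 4)) \<le> card X * ln R"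
    using R by (simp add: divide_right_mono mult_ac)
  then show ?thesis using cX by (simp add: R_def)
qed

text \<open>A longest triangular list of large-spectrum characters works: if \<open>v\<close>
  annihilates the list but \<open>chi u v = -1\<close> for another large \<open>u\<close>, then
  \<open>(u, v)\<close> extends the list. The length bound makes a longest list exist.\<close>

lemma chang:
  assumes X: "X \<subseteq> G" "X \<noteq> {}"
  obtains L where "triangular L" "length L * (ln (27/16) / 4) \<le> ln (card G / card X)"
    and "\<And>u v. \<lbrakk>u \<in> G; v \<in> annihilator L; 1/2 \<le> \<bar>mean_chi X u\<bar>\<rbrakk> \<Longrightarrow> chi u v = 1"
proof -
  define P where "P L \<longleftrightarrow> triangular L \<and> (\<forall>p\<in>set L. 1/2 \<le> \<bar>mean_chi X (fst p)\<bar>)" for L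
  have k: "ln (27/16) / 4 > (0::real)" by simp
  have bound: "length L \<le> nat \<lceil>ln (card G / card X) / (ln (27/16) / 4)\<rceil>" if "P L" for L
    using chang_length_bound[OF _ X, of L] that k pos_le_divide_eq[OF k]
    unfolding P_def by (meson le_nat_iff real_nat_ceiling_ge of_nat_le_iff order_trans)
  have "P []" by (simp add: P_def)
  from ex_has_greatest_nat[of P, OF this, of length] bound
  obtain L where L: "P L" and max: "\<And>L'. P L' \<Longrightarrow> length L' \<le> length L"
    by (metis less_Suc_eq_le)
  have "chi u v = 1" if "u \<in> G" "v \<in> annihilator L" "1/2 \<le> \<bar>mean_chi X u\<bar>" for u v
  proof (rule ccontr)
    assume "chi u v \<noteq> 1"
    then have "chi u v = -1" using that chi_cases by (auto simp: annihilator_def)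
    then have "P ((u, v) # L)" using that L by (auto simp: P_def annihilator_def)
    then show False using max by fastforce
  qed
  then show ?thesis using that L chang_length_bound[OF _ X, of L] by (auto simp: P_def)
qed

end

section \<open>Almost-periodicity and Bogolyubov's theorem\<close>

lemma exp_le_quadratic:
  fixes x :: real
  assumes "\<bar>x\<bar> \<le> 1"
  shows "exp x \<le> 1 + x + x\<^sup>2"
proof (cases "0 \<le> x")
  case True
  then show ?thesis using assms by (intro exp_bound) auto
next
  case False
  define y where "y = - x"
  have y: "0 \<le> y" using False by (simp add: y_def)
  have e: "1 + y + y\<^sup>2 / 2 \<le> exp y" by (rule exp_lower_Taylor_quadratic[OF y])
  have "0 \<le> 1 - y + y\<^sup>2" using sum_squares_ge_zero[of "1 - y" y] y
    by (simp add: power2_eq_square algebra_simps)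
  then have "(1 - y + y\<^sup>2) * (1 + y + y\<^sup>2 / 2) \<le> (1 - y + y\<^sup>2) * exp y"
    using e by (rule mult_left_mono[rotated])
  moreover have "(1 - y + y\<^sup>2) * (1 + y + y\<^sup>2 / 2) = 1 + (y^2 + y^3 + y^4) / 2"
    by (simp add: field_simps power2_eq_square power3_eq_cube power4_eq_xxxx)
  ultimately have "1 \<le> (1 - y + y\<^sup>2) * exp y" using y
    by (smt (verit) zero_le_power divide_nonneg_pos)
  then show ?thesis by (simp add: y_def exp_minus field_simps)
qed

text \<open>Chernoff's method in counting form: the coordinates of a uniform \<open>w\<close> are
  independent, so the exponential sum over all \<open>w\<close> is a \<open>k\<close>-th power, and
  the vanishing sum of \<open>h\<close> removes the linear term of each factor.\<close>

lemma card_large_sum_le: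
  fixes h :: "'a \<Rightarrow> real"
  assumes A: "finite A" and h: "\<And>a. a \<in> A \<Longrightarrow> \<bar>h a\<bar> \<le> 1" "(\<Sum>a\<in>A. h a) = 0"
    and \<epsilon>: "0 \<le> \<epsilon>" "\<epsilon> \<le> 1"
  shows "card {w \<in> {..<k} \<rightarrow>\<^sub>E A. k * \<epsilon> < (\<Sum>i<k. h (w i))}
    \<le> exp (- real k * \<epsilon>\<^sup>2 / 4) * card A ^ k"
proof -
  define W where "W = {..<k} \<rightarrow>\<^sub>E A"
  have fW: "finite W" unfolding W_def using A by (intro finite_PiE) auto
  \<comment> \<open>This value minimises the final exponent
    \<open>l\<^sup>2 - l * \<epsilon>\<close>.\<close>
  define l where "l = \<epsilon> / 2"
  have l: "0 \<le> l" "l \<le> 1" using \<epsilon> by (auto simp: l_def)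
  let ?B = "{w \<in> W. k * \<epsilon> < (\<Sum>i<k. h (w i))}"
  have "card ?B * exp (l * (k * \<epsilon>)) = (\<Sum>w\<in>?B. exp (l * (k * \<epsilon>)))" by simp
  also have "\<dots> \<le> (\<Sum>w\<in>?B. exp (l * (\<Sum>i<k. h (w i))))"
    using l by (intro sum_mono) (auto intro: mult_left_mono)
  also have "\<dots> \<le> (\<Sum>w\<in>W. exp (l * (\<Sum>i<k. h (w i))))"
    using fW by (intro sum_mono2) auto
  also have "\<dots> = (\<Sum>w\<in>W. \<Prod>i<k. exp (l * h (w i)))"
    by (simp add: sum_distrib_left exp_sum)
  also have "\<dots> = (\<Prod>i<k. \<Sum>a\<in>A. exp (l * h a))"
    unfolding W_def using A by (subst prod_sum_PiE) auto
  also have "\<dots> = (\<Sum>a\<in>A. exp (l * h a)) ^ k" by simp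
  also have "\<dots> \<le> (card A * exp (l\<^sup>2)) ^ k"
  proof (rule power_mono)
    have "(\<Sum>a\<in>A. exp (l * h a)) \<le> (\<Sum>a\<in>A. 1 + l * h a + l\<^sup>2)"
    proof (rule sum_mono)
      fix a assume "a \<in> A"
      then have ha: "\<bar>h a\<bar> \<le> 1" using h by blast
      then have "\<bar>l * h a\<bar> \<le> 1" using l by (simp add: abs_mult mult_le_one)
      then have "exp (l * h a) \<le> 1 + l * h a + (l * h a)\<^sup>2" by (rule exp_le_quadratic)
      also have "(l * h a)\<^sup>2 \<le> l\<^sup>2 * 1"
        unfolding power_mult_distrib using ha
        by (intro mult_left_mono) (auto simp: abs_square_le_1)
      finally show "exp (l * h a) \<le> 1 + l * h a + l\<^sup>2" by simp
    qed
    also have "\<dots> = card A * (1 + l\<^sup>2)"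
      using h(2) by (simp add: sum.distrib sum_distrib_left[symmetric] algebra_simps)
    also have "\<dots> \<le> card A * exp (l\<^sup>2)"
      by (intro mult_left_mono exp_ge_add_one_self) auto
    finally show "(\<Sum>a\<in>A. exp (l * h a)) \<le> card A * exp (l\<^sup>2)" .
  qed (intro sum_nonneg, simp)
  also have "\<dots> = card A ^ k * exp (k * l\<^sup>2)"
    by (simp add: power_mult_distrib exp_of_nat_mult)
  finally have "card ?B \<le> card A ^ k * exp (k * l\<^sup>2) / exp (l * (k * \<epsilon>))"
    by (simp add: pos_le_divide_eq)
  also have "\<dots> = card A ^ k * exp (k * l\<^sup>2 - l * (k * \<epsilon>))" by (simp add: exp_diff)
  also have "k * l\<^sup>2 - l * (k * \<epsilon>) = - real k * \<epsilon>\<^sup>2 / 4"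
    by (simp add: l_def field_simps power2_eq_square)
  finally show ?thesis by (simp add: W_def mult.commute)
qed

lemma card_large_abs_sum_le:
  fixes h :: "'a \<Rightarrow> real"
  assumes A: "finite A" and h: "\<And>a. a \<in> A \<Longrightarrow> \<bar>h a\<bar> \<le> 1" "(\<Sum>a\<in>A. h a) = 0"
    and \<epsilon>: "0 \<le> \<epsilon>" "\<epsilon> \<le> 1"
  shows "card {w \<in> {..<k} \<rightarrow>\<^sub>E A. k * \<epsilon> < \<bar>\<Sum>i<k. h (w i)\<bar>}
    \<le> 2 * exp (- real k * \<epsilon>\<^sup>2 / 4) * card A ^ k"
proof -
  define W where "W = {..<k} \<rightarrow>\<^sub>E A"
  have fW: "finite W" unfolding W_def using A by (intro finite_PiE) auto
  let ?P = "{w \<in> W. k * \<epsilon> < (\<Sum>i<k. h (w i))}"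
  let ?N = "{w \<in> W. k * \<epsilon> < (\<Sum>i<k. - h (w i))}"
  have "card {w \<in> W. k * \<epsilon> < \<bar>\<Sum>i<k. h (w i)\<bar>} \<le> card (?P \<union> ?N)"
    by (rule card_mono) (use fW in \<open>auto simp: sum_negf\<close>)
  also have "\<dots> \<le> card ?P + card ?N" by (rule card_Un_le)
  finally have "real (card {w \<in> W. k * \<epsilon> < \<bar>\<Sum>i<k. h (w i)\<bar>}) \<le> real (card ?P) + real (card ?N)"
    by linarith
  moreover have "real (card ?P) \<le> exp (- real k * \<epsilon>\<^sup>2 / 4) * card A ^ k"
    unfolding W_def by (rule card_large_sum_le[OF A h \<epsilon>])
  moreover have "real (card ?N) \<le> exp (- real k * \<epsilon>\<^sup>2 / 4) * card A ^ k"
    unfolding W_def by (rule card_large_sum_le[OF A _ _ \<epsilon>]) (use h in \<open>auto simp: sum_negf\<close>)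
  ultimately show ?thesis unfolding W_def by linarith
qed

context self_dual_2group
begin

text \<open>For most \<open>w \<in> A\<^sup>k\<close> the empirical mean of the translates of \<open>s\<close> by \<open>w\<close> approximates \<open>av A s\<close>
  outside a small set. By pigeonhole many diagonal translates of one \<open>z \<in> G\<^sup>k\<close> are of this kind,
  and then the corresponding translates of \<open>av A s\<close> are close to one common function.\<close>

lemma croot_sisask:
  fixes s :: "'a \<Rightarrow> real" and \<epsilon> \<eta> :: real
  assumes A: "A \<subseteq> G" "A \<noteq> {}" and s: "\<And>x. x \<in> G \<Longrightarrow> 0 \<le> s x \<and> s x \<le> 1"
    and \<epsilon>: "0 \<le> \<epsilon>" "\<epsilon> \<le> 1" and k: "0 < k"
    and \<eta>: "\<eta> = 2 * exp (- real k * \<epsilon>\<^sup>2 / 4)"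
  obtains X where "X \<subseteq> G" "card G * card A ^ k \<le> 2 * card X * card G ^ k"
    and "\<And>x x'. \<lbrakk>x \<in> X; x' \<in> X\<rbrakk> \<Longrightarrow>
      card {y \<in> G. 2 * \<epsilon> < \<bar>av A s (y \<oplus> x) - av A s (y \<oplus> x')\<bar>} \<le> 4 * \<eta> * card G"
proof -
  define g where "g = av A s"
  have fA: "finite A" using A finite_subset fin by blast
  have cA: "card A > 0" using fA A by (simp add: card_gt_0_iff)
  have \<eta>0: "\<eta> > 0" unfolding \<eta> by simp
  define W where "W = {..<k} \<rightarrow>\<^sub>E A"
  define U where "U = {..<k} \<rightarrow>\<^sub>E G"
  have fW: "finite W" unfolding W_def using fA by (intro finite_PiE) auto
  have fU: "finite U" unfolding U_def by (intro finite_PiE) auto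
  have cW: "card W = card A ^ k" by (simp add: W_def card_PiE)
  have cU: "card U = card G ^ k" by (simp add: U_def card_PiE)
  define bad where "bad w = {y \<in> G. k * \<epsilon> < \<bar>\<Sum>i<k. s (y \<oplus> w i) - g y\<bar>}" for w
  \<comment> \<open>By Markov's inequality, at most half of \<open>W\<close> exceeds twice the bound
    on the average number of bad points.\<close>
  define M where "M = {w \<in> W. card (bad w) \<le> 2 * \<eta> * card G}"
  have g01: "0 \<le> g y \<and> g y \<le> 1" if y: "y \<in> G" for y
    unfolding g_def by (rule av_nonneg_le_one[of A s, OF A s y])
  have few: "card {w \<in> W. k * \<epsilon> < \<bar>\<Sum>i<k. s (y \<oplus> w i) - g y\<bar>} \<le> \<eta> * card A ^ k"
    if y: "y \<in> G" for y
    unfolding W_def \<eta>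
  proof (rule card_large_abs_sum_le[of A "\<lambda>a. s (y \<oplus> a) - g y", OF fA _ _ \<epsilon>])
    show "\<bar>s (y \<oplus> a) - g y\<bar> \<le> 1" if "a \<in> A" for a
    proof -
      have "y \<oplus> a \<in> G" using y that A by auto
      then show ?thesis using s[of "y \<oplus> a"] g01[OF y] by auto
    qed
    show "(\<Sum>a\<in>A. s (y \<oplus> a) - g y) = 0"
      using cA by (simp add: sum_subtractf g_def av_def)
  qed
  have "(\<Sum>w\<in>W. real (card (bad w)))
      = (\<Sum>w\<in>W. \<Sum>y\<in>G. if k * \<epsilon> < \<bar>\<Sum>i<k. s (y \<oplus> w i) - g y\<bar> then 1 else 0)"
    unfolding bad_def by (simp add: sum.If_cases Int_def)
  also have "\<dots> = (\<Sum>y\<in>G. real (card {w \<in> W. k * \<epsilon> < \<bar>\<Sum>i<k. s (y \<oplus> w i) - g y\<bar>}))"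
    by (subst sum.swap) (simp add: fW sum.If_cases Int_def)
  also have "\<dots> \<le> (\<Sum>y\<in>G. \<eta> * card A ^ k)" by (intro sum_mono few)
  finally have tot: "(\<Sum>w\<in>W. real (card (bad w))) \<le> card G * (\<eta> * card A ^ k)" by simp
  have "card (W - M) * (2 * \<eta> * card G) = (\<Sum>w\<in>W - M. 2 * \<eta> * card G)" by simp
  also have "\<dots> \<le> (\<Sum>w\<in>W - M. real (card (bad w)))"
    by (intro sum_mono) (auto simp: M_def)
  also have "\<dots> \<le> (\<Sum>w\<in>W. real (card (bad w)))" using fW by (intro sum_mono2) auto
  also note tot
  finally have "(2 * card (W - M)) * (\<eta> * card G) \<le> real (card A) ^ k * (\<eta> * card G)"
    by (simp add: mult_ac)
  then have "2 * real (card (W - M)) \<le> real (card A) ^ k"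
    using \<eta>0 by (subst (asm) mult_le_cancel_right_pos) auto
  moreover have "card (W - M) = card W - card M" "card M \<le> card W"
    using fW by (auto simp: M_def intro: card_Diff_subset card_mono)
  ultimately have cM: "card A ^ k \<le> 2 * card M"
    by (simp add: cW of_nat_diff) (metis (mono_tags) of_nat_le_iff of_nat_mult of_nat_numeral of_nat_power)
  define sh where "sh x z = (\<lambda>i\<in>{..<k}. z i \<oplus> x)" for x :: 'a and z :: "nat \<Rightarrow> 'a"
  have sh_sh: "sh x (sh x z) = z" if "x \<in> G" "z \<in> U" for x z
  proof (rule PiE_ext)
    show "sh x (sh x z) \<in> {..<k} \<rightarrow>\<^sub>E G"
      using that unfolding sh_def U_def restrict_PiE_iff by (metis PiE_mem add_closed restrict_apply')
    show "z \<in> {..<k} \<rightarrow>\<^sub>E G" using that by (simp add: U_def)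
    show "sh x (sh x z) i = z i" if "i \<in> {..<k}" for i
      using \<open>x \<in> G\<close> PiE_mem[OF \<open>z \<in> U\<close>[unfolded U_def] that] that by (simp add: sh_def)
  qed
  have sh_U: "sh x z \<in> U" if "x \<in> G" "z \<in> U" for x z
    using that unfolding sh_def U_def restrict_PiE_iff by (metis PiE_mem add_closed)
  have MU: "M \<subseteq> U" using A(1) PiE_mono[of "{..<k}" "\<lambda>_. A" "\<lambda>_. G"] unfolding M_def W_def U_def by blast
  have cz: "card {z \<in> U. sh x z \<in> M} = card M" if x: "x \<in> G" for x
    by (rule bij_betw_same_card[of "sh x"],
        rule bij_betw_byWitness[where f' = "sh x"]) (use MU x in \<open>auto simp: sh_sh sh_U subset_iff\<close>)
  have dc: "(\<Sum>z\<in>U. card {x \<in> G. sh x z \<in> M}) = card G * card M"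
  proof -
    have "(\<Sum>z\<in>U. card {x \<in> G. sh x z \<in> M}) = (\<Sum>z\<in>U. \<Sum>x\<in>G. if sh x z \<in> M then 1 else 0)"
      by (simp add: sum.If_cases Int_def)
    also have "\<dots> = (\<Sum>x\<in>G. card {z \<in> U. sh x z \<in> M})"
      by (subst sum.swap) (simp add: fU sum.If_cases Int_def)
    finally show ?thesis by (simp add: cz)
  qed
  \<comment> \<open>Each \<open>x\<close> carries exactly \<open>card M\<close> points
    \<open>z\<close> into \<open>M\<close>, so some \<open>z\<close> is carried into
    \<open>M\<close> by at least the average number of \<open>x\<close>.\<close>
  have "\<exists>z\<in>U. card G * card M \<le> card U * card {x \<in> G. sh x z \<in> M}"
  proof (rule ccontr)
    assume "\<not> ?thesis"
    then have "(\<Sum>z\<in>U. card U * card {x \<in> G. sh x z \<in> M}) < (\<Sum>z\<in>U. card G * card M)"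
      using fU by (intro sum_strict_mono)
        (auto simp: not_le, metis cU card.empty card_pos less_irrefl zero_less_power)
    then show False by (simp add: sum_distrib_left[symmetric] dc)
  qed
  then obtain z where z: "z \<in> U" "card G * card M \<le> card U * card {x \<in> G. sh x z \<in> M}" by blast
  define X where "X = {x \<in> G. sh x z \<in> M}"
  have zi: "z i \<in> G" if "i < k" for i using PiE_mem[OF z(1)[unfolded U_def]] that by simp
  \<comment> \<open>At \<open>y \<oplus> x\<close> the sample \<open>sh x z\<close> reads
    \<open>s\<close> at the points \<open>y \<oplus> z i\<close>. The sample sum no longer involves
    \<open>x\<close>, so it mediates between any two elements of \<open>X\<close>.\<close>
  define D where "D x = {y \<in> G. k * \<epsilon> < \<bar>(\<Sum>i<k. s (y \<oplus> z i)) - k * g (y \<oplus> x)\<bar>}" for x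
  have cD: "card (D x) \<le> 2 * \<eta> * card G" if x: "x \<in> X" for x
  proof -
    have xG: "x \<in> G" using x by (simp add: X_def)
    have "(y \<oplus> x) \<oplus> (z i \<oplus> x) = y \<oplus> z i" if "y \<in> G" "i < k" for y i
      using that xG zi by (simp add: g_ac)
    then have "(\<Sum>i<k. s ((y \<oplus> x) \<oplus> sh x z i) - g (y \<oplus> x)) = (\<Sum>i<k. s (y \<oplus> z i)) - k * g (y \<oplus> x)"
      if "y \<in> G" for y using that by (simp add: sh_def sum_subtractf)
    then have "card (D x) \<le> card (bad (sh x z))"
      using xG inj_on_subset[OF bij_betw_imp_inj_on[OF bij_shift[OF xG]]]
      by (intro card_inj_on_le[of "\<lambda>y. y \<oplus> x"]) (auto simp: D_def bad_def)
    then show ?thesis using x by (simp add: X_def M_def)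
  qed
  show ?thesis
  proof
    show "X \<subseteq> G" by (auto simp: X_def)
    have "card G * card A ^ k \<le> card G * (2 * card M)" using cM by (rule mult_le_mono2)
    also have "\<dots> \<le> 2 * (card U * card X)" using z(2) by (simp add: X_def)
    finally show "card G * card A ^ k \<le> 2 * card X * card G ^ k" by (simp add: cU mult_ac)
    fix x x' assume x: "x \<in> X" "x' \<in> X"
    have "y \<in> D x \<union> D x'" if y: "y \<in> G" "2 * \<epsilon> < \<bar>g (y \<oplus> x) - g (y \<oplus> x')\<bar>" for y
    proof (rule ccontr)
      assume "y \<notin> D x \<union> D x'"
      then have "\<bar>k * g (y \<oplus> x) - k * g (y \<oplus> x')\<bar> \<le> 2 * (k * \<epsilon>)" using y by (auto simp: D_def)
      moreover have "\<bar>k * g (y \<oplus> x) - k * g (y \<oplus> x')\<bar> = k * \<bar>g (y \<oplus> x) - g (y \<oplus> x')\<bar>"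
        by (simp add: abs_mult flip: right_diff_distrib)
      ultimately have "k * \<bar>g (y \<oplus> x) - g (y \<oplus> x')\<bar> \<le> k * (2 * \<epsilon>)" by simp
      then show False using y k by simp
    qed
    then have "card {y \<in> G. 2 * \<epsilon> < \<bar>g (y \<oplus> x) - g (y \<oplus> x')\<bar>} \<le> card (D x \<union> D x')"
      by (intro card_mono) (auto simp: D_def)
    also have "\<dots> \<le> card (D x) + card (D x')" by (rule card_Un_le)
    finally show "card {y \<in> G. 2 * \<epsilon> < \<bar>av A s (y \<oplus> x) - av A s (y \<oplus> x')\<bar>} \<le> 4 * \<eta> * card G"
      using cD[OF x(1)] cD[OF x(2)] unfolding g_def by linarith
  qed
qed

text \<open>One more average over \<open>A\<close> upgrades closeness off a small set to closeness
  everywhere: the points \<open>y \<oplus> a\<close> are distinct, so at most \<open>c\<close> of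
  them are exceptional, and there the error is at most 1.\<close>

lemma av_close_of_few_exceptions:
  fixes c \<delta> :: real
  assumes A: "A \<subseteq> G" "A \<noteq> {}" and g: "\<And>x. x \<in> G \<Longrightarrow> 0 \<le> g x \<and> g x \<le> 1"
    and G: "x \<in> G" "x' \<in> G" "y \<in> G" and \<delta>: "0 \<le> \<delta>"
    and few: "card {y \<in> G. \<delta> < \<bar>g (y \<oplus> x) - g (y \<oplus> x')\<bar>} \<le> c"
  shows "\<bar>av A g (y \<oplus> x) - av A g (y \<oplus> x')\<bar> \<le> \<delta> + c / card A"
proof -
  have fA: "finite A" using A finite_subset fin by blast
  have cA: "card A > 0" using fA A by (simp add: card_gt_0_iff)
  define D where "D = {y \<in> G. \<delta> < \<bar>g (y \<oplus> x) - g (y \<oplus> x')\<bar>}"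
  have "av A g (y \<oplus> x) - av A g (y \<oplus> x') = (\<Sum>a\<in>A. g (y \<oplus> x \<oplus> a) - g (y \<oplus> x' \<oplus> a)) / card A"
    by (simp add: av_def sum_subtractf diff_divide_distrib)
  also have "\<bar>\<dots>\<bar> \<le> (\<Sum>a\<in>A. \<bar>g (y \<oplus> x \<oplus> a) - g (y \<oplus> x' \<oplus> a)\<bar>) / card A"
    by (simp add: divide_right_mono sum_abs)
  also have "\<dots> \<le> (\<Sum>a\<in>A. \<delta> + (if y \<oplus> a \<in> D then 1 else 0)) / card A"
  proof (intro divide_right_mono sum_mono)
    fix a assume "a \<in> A"
    then have a: "a \<in> G" using A by auto
    then have sw: "y \<oplus> x \<oplus> a = y \<oplus> a \<oplus> x" "y \<oplus> x' \<oplus> a = y \<oplus> a \<oplus> x'"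
      using G by (auto simp: g_ac)
    have "\<bar>g (y \<oplus> a \<oplus> x) - g (y \<oplus> a \<oplus> x')\<bar> \<le> 1"
      using g[of "y \<oplus> a \<oplus> x"] g[of "y \<oplus> a \<oplus> x'"] G a by auto
    then show "\<bar>g (y \<oplus> x \<oplus> a) - g (y \<oplus> x' \<oplus> a)\<bar> \<le> \<delta> + (if y \<oplus> a \<in> D then 1 else 0)"
      unfolding sw using \<delta> G a by (auto simp: D_def)
  qed simp
  also have "(\<Sum>a\<in>A. \<delta> + (if y \<oplus> a \<in> D then 1 else 0)) = card A * \<delta> + card {a \<in> A. y \<oplus> a \<in> D}"
    using fA by (simp add: sum.distrib sum.If_cases Int_def)
  also have "card {a \<in> A. y \<oplus> a \<in> D} \<le> card D"
  proof (rule card_inj_on_le)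
    show "inj_on (\<lambda>a. y \<oplus> a) {a \<in> A. y \<oplus> a \<in> D}"
      using A G by (intro inj_onI) (metis (no_types, lifting) add_cancel(2) mem_Collect_eq subsetD)
  qed (auto simp: D_def)
  also have "real (card D) \<le> c" using few by (simp add: D_def)
  finally show ?thesis using cA by (simp add: divide_right_mono add_divide_distrib)
qed

text \<open>With \<open>s\<close> the indicator of \<open>A + A\<close>, the function \<open>H = av A (av A s)\<close> has \<open>H 0 = 1\<close> and is
  uniformly almost invariant under \<open>Y\<close>, hence close to \<open>Q = (av Y)\<^sup>t H\<close>. Averaging \<open>t\<close> times over
  \<open>Y\<close> suppresses all characters outside the large spectrum of \<open>Y\<close>, so \<open>Q\<close> is almost constant on
  the annihilator of that spectrum. Thus \<open>H\<close> is positive there, and this puts it inside \<open>4A\<close>.\<close>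

lemma bogolyubov:
  assumes A: "A \<subseteq> G" and dens: "card G \<le> 2 ^ L * card A" and L: "1 \<le> L"
  obtains \<Lambda> where "triangular \<Lambda>" "length \<Lambda> \<le> 2 ^ 24 * L ^ 4"
    and "\<And>v. v \<in> annihilator \<Lambda> \<Longrightarrow> \<exists>a\<in>A. \<exists>b\<in>A. \<exists>c\<in>A. \<exists>d\<in>A. v = a \<oplus> b \<oplus> c \<oplus> d"
proof -
  have fA: "finite A" using A finite_subset fin by blast
  have cA: "card A > 0" using dens card_pos by (metis gr0I mult_0_right not_le)
  then have A0: "A \<noteq> {}" by auto
  have dens': "real (card G) / card A \<le> 2 ^ L"
    using of_nat_mono[OF dens, where 'a = real] cA by (simp add: pos_divide_le_eq)
  define s :: "'a \<Rightarrow> real" where "s x = (if \<exists>a\<in>A. \<exists>b\<in>A. x = a \<oplus> b then 1 else 0)" for x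
  have s01: "0 \<le> s x \<and> s x \<le> 1" for x by (simp add: s_def)
  \<comment> \<open>\<open>t\<close> makes the bound \<open>2 * (1/2) ^ t * 2 ^ L\<close> on the
    smoothed tail equal to 1/4, and \<open>\<epsilon>\<close> makes
    \<open>t * (2 * \<epsilon>)\<close> equal to 1/16. \<open>k\<close> makes
    \<open>k * \<epsilon>\<^sup>2 / 4\<close> equal to \<open>4 * t\<close>, so that
    \<open>\<eta>\<close> beats \<open>2 ^ L\<close> and the rest of \<open>t * \<delta>\<close> is
    at most 1/16.\<close>
  define t where "t = L + 3"
  define k where "k = 16384 * t ^ 3"
  define \<epsilon> where "\<epsilon> = 1 / (32 * real t)"
  define \<eta> where "\<eta> = 2 * exp (- real k * \<epsilon>\<^sup>2 / 4)"
  have t: "t > 0" "t \<ge> 2" by (auto simp: t_def)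
  have \<epsilon>: "0 \<le> \<epsilon>" "\<epsilon> \<le> 1" using t by (auto simp: \<epsilon>_def divide_le_eq)
  have \<eta>_eq: "\<eta> = 2 * exp (- (4 * real t))"
    using t by (simp add: \<eta>_def k_def \<epsilon>_def power2_eq_square power3_eq_cube field_simps)
  have "k > 0" using t by (simp add: k_def)
  then obtain X where X: "X \<subseteq> G" "card G * card A ^ k \<le> 2 * card X * card G ^ k"
    and few: "\<And>x x'. \<lbrakk>x \<in> X; x' \<in> X\<rbrakk> \<Longrightarrow>
      card {y \<in> G. 2 * \<epsilon> < \<bar>av A s (y \<oplus> x) - av A s (y \<oplus> x')\<bar>} \<le> 4 * \<eta> * card G"
    by (rule croot_sisask[of A s, OF A A0 s01 \<epsilon> _ \<eta>_def]) blast
  have fX: "finite X" using X finite_subset fin by blast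
  have cX: "card X > 0"
    using X(2) cA card_pos
    by (metis gr0I mult_0 mult_0_right mult_pos_pos not_le zero_less_power)
  then obtain x0 where x0: "x0 \<in> X" by fastforce
  then have x0G: "x0 \<in> G" using X by auto
  \<comment> \<open>Translating by one of its elements turns comparison of pairs in \<open>X\<close>
    into almost-invariance under single elements of \<open>Y\<close>, at the same density.\<close>
  define Y where "Y = (\<lambda>x. x \<oplus> x0) ` X"
  have Y: "Y \<subseteq> G" "Y \<noteq> {}" using X x0 x0G by (auto simp: Y_def)
  have cY: "card Y = card X" unfolding Y_def
    by (rule card_image) (rule inj_on_subset[OF bij_betw_imp_inj_on[OF bij_shift[OF x0G]] X(1)])
  define H where "H = av A (av A s)"
  define \<delta> where "\<delta> = 2 * \<epsilon> + 4 * \<eta> * card G / card A"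
  have close: "\<bar>H (y \<oplus> u) - H y\<bar> \<le> \<delta>" if "u \<in> Y" "y \<in> G" for u y
  proof -
    obtain x where x: "x \<in> X" "u = x \<oplus> x0" using \<open>u \<in> Y\<close> by (auto simp: Y_def)
    have xG: "x \<in> G" using x X by auto
    have "\<bar>H (y \<oplus> x0 \<oplus> x) - H (y \<oplus> x0 \<oplus> x0)\<bar> \<le> \<delta>"
      unfolding H_def \<delta>_def
      by (rule av_close_of_few_exceptions[of A "av A s", OF A A0 av_nonneg_le_one[of A s, OF A A0 s01]])
         (use xG x0G x0 x \<epsilon> few that in auto)
    moreover have "y \<oplus> x0 \<oplus> x = y \<oplus> u" using x xG x0G that by (simp add: g_ac)
    ultimately show ?thesis using x0G that by simp
  qed
  have t\<delta>: "t * \<delta> \<le> 1 / 8"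
  proof -
    have "real t * 2 ^ 7 * 2 ^ L = real t * 2 ^ 4 * 2 ^ t" by (simp add: t_def power_add)
    also have "\<dots> \<le> 2 ^ t * 2 ^ (2 * t) * 2 ^ t"
    proof (intro mult_mono mult_right_mono)
      show "real t \<le> 2 ^ t" by (rule less_imp_le[OF of_nat_less_two_power])
      have "4 \<le> 2 * t" using t by simp
      then show "(2::real) ^ 4 \<le> 2 ^ (2 * t)" by (intro power_increasing) auto
    qed auto
    also have "\<dots> = 2 ^ (4 * t)" by (simp flip: power_add)
    also have "\<dots> \<le> exp 1 ^ (4 * t)" using exp_ge_add_one_self[of 1] by (intro power_mono) auto
    also have "\<dots> = exp (4 * real t)" by (simp flip: exp_of_nat_mult)
    finally have e: "real t * 2 ^ 7 * 2 ^ L * exp (- (4 * real t)) \<le> 1"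
      by (simp add: exp_minus field_simps)
    have "4 * \<eta> * (card G / card A) \<le> 4 * \<eta> * 2 ^ L"
      by (intro mult_left_mono dens') (auto simp: \<eta>_eq)
    then have "t * (4 * \<eta> * card G / card A) \<le> t * (4 * \<eta> * 2 ^ L)"
      by (intro mult_left_mono) auto
    moreover have "t * (2 * \<epsilon>) = 1 / 16" using t by (simp add: \<epsilon>_def)
    moreover have "t * (4 * \<eta> * 2 ^ L) \<le> 1 / 16" using e by (simp add: \<eta>_eq mult_ac)
    ultimately show ?thesis by (simp add: \<delta>_def distrib_left)
  qed
  define Q where "Q = (av Y ^^ t) H"
  have QH: "\<bar>Q y - H y\<bar> \<le> 1 / 8" if "y \<in> G" for y
    using av_pow_close[OF Y that close, of t] t\<delta> unfolding Q_def by linarith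
  have H0: "H \<zero> = 1"
  proof -
    have "s (\<zero> \<oplus> a \<oplus> b) = 1" if "a \<in> A" "b \<in> A" for a b
      using that A by (auto simp: s_def subset_iff)
    then show ?thesis using cA by (simp add: H_def av_def)
  qed
  obtain \<Lambda> where \<Lambda>: "triangular \<Lambda>" "length \<Lambda> * (ln (27/16) / 4) \<le> ln (card G / card Y)"
    and spec: "\<And>u v. \<lbrakk>u \<in> G; v \<in> annihilator \<Lambda>; 1/2 \<le> \<bar>mean_chi Y u\<bar>\<rbrakk> \<Longrightarrow> chi u v = 1"
    using chang[OF Y] by blast
  have sums: "\<exists>a\<in>A. \<exists>b\<in>A. \<exists>c\<in>A. \<exists>d\<in>A. v = a \<oplus> b \<oplus> c \<oplus> d" if v: "v \<in> annihilator \<Lambda>" for v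
  proof -
    have vG: "v \<in> G" using v by (simp add: annihilator_def)
    \<comment> \<open>The coefficients of \<open>Q\<close>. One factor \<open>mean_chi A\<close> per
      average over \<open>A\<close> gives the square for Parseval; the power of
      \<open>mean_chi Y\<close> gives the decay off the large spectrum.\<close>
    define q where "q u = fourier s u * mean_chi A u * mean_chi A u * mean_chi Y u ^ t" for u
    have Qexp: "Q y = (\<Sum>u\<in>G. q u * chi u y)" if "y \<in> G" for y
      unfolding Q_def q_def H_def
      by (rule av_pow_chi_expansion[OF Y(1) that], rule av_chi_expansion[OF A], assumption,
          rule av_chi_expansion[OF A], assumption, rule fourier_inversion)
    have "\<bar>Q v - Q \<zero>\<bar> = \<bar>\<Sum>u\<in>G. q u * (chi u v - 1)\<bar>"
      using vG by (simp add: Qexp right_diff_distrib sum_subtractf)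
    also have "\<dots> \<le> (\<Sum>u\<in>G. \<bar>q u * (chi u v - 1)\<bar>)" by (rule sum_abs)
    also have "\<dots> \<le> (\<Sum>u\<in>G. 2 * (1/2) ^ t * (mean_chi A u)\<^sup>2)"
    proof (rule sum_mono)
      fix u assume u: "u \<in> G"
      show "\<bar>q u * (chi u v - 1)\<bar> \<le> 2 * (1/2) ^ t * (mean_chi A u)\<^sup>2"
      proof (cases "1/2 \<le> \<bar>mean_chi Y u\<bar>")
        case True
        then show ?thesis using spec[OF u v] by simp
      next
        case False
        have "\<bar>fourier s u\<bar> \<le> 1" using u s01 by (intro abs_fourier_le) auto
        moreover have "\<bar>mean_chi Y u\<bar> ^ t \<le> (1/2) ^ t" using False by (intro power_mono) auto
        moreover have "\<bar>chi u v - 1\<bar> \<le> 2" using chi_cases[OF u vG] by auto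
        ultimately have "\<bar>fourier s u\<bar> * (\<bar>mean_chi Y u\<bar> ^ t * \<bar>chi u v - 1\<bar>) \<le> 1 * ((1/2) ^ t * 2)"
          by (intro mult_mono) auto
        then have "\<bar>fourier s u\<bar> * (\<bar>mean_chi Y u\<bar> ^ t * \<bar>chi u v - 1\<bar>) * (mean_chi A u)\<^sup>2
            \<le> 1 * ((1/2) ^ t * 2) * (mean_chi A u)\<^sup>2"
          by (rule mult_right_mono) simp
        moreover have "\<bar>q u * (chi u v - 1)\<bar>
            = \<bar>fourier s u\<bar> * (\<bar>mean_chi Y u\<bar> ^ t * \<bar>chi u v - 1\<bar>) * (mean_chi A u)\<^sup>2"
          by (simp add: q_def abs_mult power_abs power2_eq_square mult_ac)
        ultimately show ?thesis by (simp add: mult_ac)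
      qed
    qed
    also have "\<dots> = 2 * (1/2) ^ t * (card G / card A)"
      by (simp add: sum_distrib_left[symmetric] sum_mean_chi_sq[OF A A0])
    also have "\<dots> \<le> 2 * (1/2) ^ t * 2 ^ L"
      by (intro mult_left_mono dens') auto
    also have "\<dots> = 1 / 4" by (simp add: t_def power_add power_one_over)
    \<comment> \<open>1 - 1/8 - 1/4 - 1/8: smoothing at \<zero>, passing from \<zero> to
      \<open>v\<close>, undoing the smoothing at \<open>v\<close>.\<close>
    finally have "H v \<ge> 1 / 2" using QH[OF vG] QH[of \<zero>] H0 zero_closed
      unfolding abs_le_iff by linarith
    then have "(\<Sum>a\<in>A. \<Sum>b\<in>A. s (v \<oplus> a \<oplus> b)) \<noteq> 0"
      by (auto simp: H_def av_def simp flip: sum_divide_distrib)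
    then obtain a b where ab: "a \<in> A" "b \<in> A" "s (v \<oplus> a \<oplus> b) \<noteq> 0"
      by (meson sum.neutral)
    then obtain c d where cd: "c \<in> A" "d \<in> A" "v \<oplus> a \<oplus> b = c \<oplus> d"
      by (auto simp: s_def split: if_splits)
    have inG: "a \<in> G" "b \<in> G" "c \<in> G" "d \<in> G" using ab cd A by auto
    have "v = (v \<oplus> a \<oplus> b) \<oplus> b \<oplus> a" using inG vG by simp
    also have "\<dots> = c \<oplus> d \<oplus> b \<oplus> a" by (simp add: cd(3))
    finally show ?thesis using ab cd by blast
  qed
  \<comment> \<open>\<open>Y\<close> has density at least 2^-(L * k + 1), and 2 < (27/16)^2 bounds
    the length by 8 * (L * k + 1). With t at most 4 * L this is at most 2^23 * L^4 + 8.\<close>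
  have len: "length \<Lambda> \<le> 2 ^ 24 * L ^ 4"
  proof -
    have "card G * card A ^ k \<le> 2 * card X * (2 ^ L * card A) ^ k"
      using X(2) dens by (meson le_trans mult_le_mono2 power_mono zero_le)
    then have "card G \<le> 2 * card X * (2 ^ L) ^ k" using cA by (simp add: power_mult_distrib)
    also have "\<dots> = 2 ^ (L * k + 1) * card X" by (simp add: power_mult)
    finally have "real (card G) \<le> real (2 ^ (L * k + 1) * card X)" by (rule of_nat_mono)
    then have "real (card G) \<le> 2 ^ (L * k + 1) * card X" by simp
    then have "real (card G) / card Y \<le> 2 ^ (L * k + 1)" using cX cY by (simp add: pos_divide_le_eq)
    then have "ln (card G / card Y) \<le> ln (2 ^ (L * k + 1))"
      using cX cY by (subst ln_le_cancel_iff) auto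
    also have "\<dots> = (L * k + 1) * ln 2" by (rule ln_realpow)
    finally have 1: "length \<Lambda> * (ln (27/16) / 4) \<le> (L * k + 1) * ln 2" using \<Lambda>(2) by linarith
    have "ln (2::real) \<le> ln ((27/16) ^ 2)" by (subst ln_le_cancel_iff) (auto simp: power2_eq_square)
    also have "\<dots> = 2 * ln (27/16)" by (subst ln_realpow) auto
    finally have "ln 2 / 8 \<le> ln (27/16) / (4::real)" by simp
    then have "length \<Lambda> * (ln 2 / 8) \<le> length \<Lambda> * (ln (27/16) / 4)" by (intro mult_left_mono) auto
    also note 1
    finally have "real (length \<Lambda>) * ln 2 \<le> (8 * real (L * k + 1)) * ln 2" by linarith
    then have "real (length \<Lambda>) \<le> 8 * real (L * k + 1)" by (subst (asm) mult_le_cancel_right_pos) auto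
    then have "length \<Lambda> \<le> 8 * (L * k + 1)" by linarith
    also have "\<dots> = 2 ^ 17 * (L * t ^ 3) + 8" by (simp add: k_def)
    also have "\<dots> \<le> 2 ^ 17 * (L * (4 * L) ^ 3) + 8 * L ^ 4"
      using L by (intro add_mono mult_le_mono2 power_mono) (auto simp: t_def)
    also have "\<dots> \<le> 2 ^ 24 * L ^ 4" by (simp add: power_mult_distrib flip: power_Suc)
    finally show ?thesis .
  qed
  show ?thesis by (rule that[OF \<Lambda>(1) len sums])
qed

end

section \<open>Restriction to cosets and parity decision trees\<close>

text \<open>Gaussian elimination: a nonzero entry of row \<open>r\<close> is the pivot, its column
  is cleared from the other rows, and the pivot variable is recovered from row
  \<open>r\<close>.\<close>

lemma homogeneous_system_solution:
  fixes m :: "'r \<Rightarrow> 'u \<Rightarrow> 'f :: field"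
  assumes "finite R" "finite U" "card R < card U"
  shows "\<exists>v. (\<exists>x\<in>U. v x \<noteq> 0) \<and> (\<forall>r\<in>R. (\<Sum>x\<in>U. m r x * v x) = 0)"
  using assms
proof (induction R arbitrary: U m rule: finite_induct)
  case empty
  then obtain x where "x \<in> U" by fastforce
  then show ?case by (intro exI[of _ "\<lambda>_. 1"]) auto
next
  case (insert r R)
  show ?case
  proof (cases "\<forall>x\<in>U. m r x = 0")
    case True
    then show ?thesis using insert.IH[of U m] insert.prems insert.hyps by auto
  next
    case False
    then obtain p where p: "p \<in> U" "m r p \<noteq> 0" by blast
    define m' where "m' q x = m q x - m q p * m r x / m r p" for q x
    have "card R < card (U - {p})" using insert p by simp
    then obtain v where v: "\<exists>x\<in>U - {p}. v x \<noteq> 0"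
      and sol: "\<And>q. q \<in> R \<Longrightarrow> (\<Sum>x\<in>U - {p}. m' q x * v x) = 0"
      using insert.IH[of "U - {p}" m'] insert.prems by auto
    define t where "t = (\<Sum>x\<in>U - {p}. m r x * v x)"
    define v' where "v' = v(p := - t / m r p)"
    have split: "(\<Sum>x\<in>U. m q x * v' x) = m q p * (- t / m r p) + (\<Sum>x\<in>U - {p}. m q x * v x)" for q
      using p insert.prems
      by (subst sum.remove[of U p]) (auto simp: v'_def intro!: sum.cong)
    have "(\<Sum>x\<in>U. m q x * v' x) = 0" if "q \<in> insert r R" for q
    proof (cases "q = r")
      case True
      then show ?thesis using p by (simp add: split t_def)
    next
      case False
      then have "(\<Sum>x\<in>U - {p}. m' q x * v x) = 0" using that sol by auto
      moreover have "(\<Sum>x\<in>U - {p}. m' q x * v x)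
          = (\<Sum>x\<in>U - {p}. m q x * v x) - m q p / m r p * t"
        unfolding t_def sum_distrib_left sum_subtractf[symmetric]
        by (intro sum.cong refl) (simp add: m'_def field_simps)
      ultimately show ?thesis by (simp add: split)
    qed
    moreover have "\<exists>x\<in>U. v' x \<noteq> 0" using v by (auto simp: v'_def)
    ultimately show ?thesis by blast
  qed
qed

context self_dual_2group
begin

text \<open>Parity decision trees of depth at most \<open>d\<close> in semantic form, with
  characters as queries. Leaves are allowed at every \<open>d\<close>, so both subtrees of a query
  may share one bound.\<close>

inductive decides :: "nat \<Rightarrow> ('a \<Rightarrow> bool) \<Rightarrow> bool" where
  const: "(\<And>x. x \<in> G \<Longrightarrow> f x = b) \<Longrightarrow> decides d f"
| query: "\<lbrakk>u \<in> G; decides d f0; decides d f1;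
    \<And>x. x \<in> G \<Longrightarrow> f x = (if chi u x = 1 then f0 x else f1 x)\<rbrakk> \<Longrightarrow> decides (Suc d) f"

lemma decides_mono:
  "\<lbrakk>decides d f; d \<le> d'; \<And>x. x \<in> G \<Longrightarrow> f' x = f x\<rbrakk> \<Longrightarrow> decides d' f'"
proof (induction arbitrary: d' f' rule: decides.induct)
  case (const f b d)
  then show ?case by (intro decides.const[of f' b]) auto
next
  case (query u d f0 f1 f)
  then obtain d'' where d'': "d' = Suc d''" "d \<le> d''" by (cases d') auto
  show ?case unfolding d''(1)
    by (rule decides.query[of u d'' f0 f1]) (use query d'' in auto)
qed

fun proj :: "('a \<times> 'a) list \<Rightarrow> 'a \<Rightarrow> 'a" where
  "proj [] x = x"
| "proj ((u, e) # L) x = (if chi u (proj L x) = 1 then proj L x else proj L x \<oplus> e)"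

text \<open>\<open>proj L\<close> is a linear projection onto \<open>annihilator L\<close>; \<open>dual_proj L\<close> is its adjoint.\<close>

fun dual_proj :: "('a \<times> 'a) list \<Rightarrow> 'a \<Rightarrow> 'a" where
  "dual_proj [] w = w"
| "dual_proj ((u, e) # L) w = dual_proj L (if chi w e = 1 then w else w \<oplus> u)"

lemma proj_closed [simp]: "\<lbrakk>triangular L; x \<in> G\<rbrakk> \<Longrightarrow> proj L x \<in> G"
  by (induction L x rule: proj.induct) auto

lemma dual_proj_closed [simp]: "\<lbrakk>triangular L; w \<in> G\<rbrakk> \<Longrightarrow> dual_proj L w \<in> G"
  by (induction L w rule: dual_proj.induct) auto

lemma chi_proj: "\<lbrakk>triangular L; w \<in> G; x \<in> G\<rbrakk> \<Longrightarrow> chi w (proj L x) = chi (dual_proj L w) x"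
proof (induction L w rule: dual_proj.induct)
  case (2 u e L w)
  then have t: "triangular L" "u \<in> G" "e \<in> G" "chi u e = -1" by auto
  define y where "y = proj L x"
  have y: "y \<in> G" using t 2 by (simp add: y_def)
  have "chi w (proj ((u, e) # L) x) = chi (if chi w e = 1 then w else w \<oplus> u) y"
    using chi_cases[OF \<open>w \<in> G\<close> \<open>e \<in> G\<close>] chi_cases[OF \<open>u \<in> G\<close> y] t y 2(3)
    by (auto simp: y_def[symmetric] chi_add chi_add_left)
  also have "\<dots> = chi (dual_proj ((u, e) # L) w) x"
    unfolding y_def using 2 t by simp
  finally show ?case .
qed simp

text \<open>Pairing with any \<open>w\<close> turns \<open>proj L\<close> into the character of
  \<open>dual_proj L w\<close>, which is additive, and characters separate points.\<close>

lemma proj_add: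
  assumes "triangular L" "x \<in> G" "y \<in> G"
  shows "proj L (x \<oplus> y) = proj L x \<oplus> proj L y"
proof -
  have "proj L (x \<oplus> y) \<oplus> (proj L x \<oplus> proj L y) = \<zero>"
  proof (rule chi_nondegenerate)
    fix w assume w: "w \<in> G"
    have "chi (dual_proj L w) x * chi (dual_proj L w) y
        * (chi (dual_proj L w) x * chi (dual_proj L w) y) = 1"
      using chi_cases[of "dual_proj L w" x] chi_cases[of "dual_proj L w" y] w assms by auto
    then show "chi w (proj L (x \<oplus> y) \<oplus> (proj L x \<oplus> proj L y)) = 1"
      using assms w by (simp add: chi_add chi_proj)
  qed (use assms in auto)
  then show ?thesis using assms by (simp add: add_eq_zero_iff)
qed

text \<open>Adding \<open>e\<close> corrects the sign of \<open>chi u\<close> and keeps the tail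
  characters, which are 1 at \<open>e\<close>.\<close>

lemma proj_in_annihilator: "\<lbrakk>triangular L; x \<in> G\<rbrakk> \<Longrightarrow> proj L x \<in> annihilator L"
proof (induction L x rule: proj.induct)
  case (2 u e L x)
  then have t: "triangular L" "u \<in> G" "e \<in> G" "chi u e = -1" "\<forall>p\<in>set L. chi (fst p) e = 1"
    and y: "proj L x \<in> annihilator L" by auto
  have yG: "proj L x \<in> G" using t 2 by simp
  show ?case
    using y t triangular_closed[OF t(1)] chi_cases[OF t(2) yG]
    by (auto simp: annihilator_def chi_add)
qed (simp add: annihilator_def)

lemma dual_proj_zero [simp]: "triangular L \<Longrightarrow> dual_proj L \<zero> = \<zero>"
  by (induction L rule: triangular.induct) (auto simp: chi_sym[of \<zero>])

text \<open>The character \<open>dual_proj L u\<close> at \<open>x\<close> equals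
  \<open>chi u\<close> at \<open>proj L x\<close>, so querying it tells whether the next projection
  adds \<open>e\<close>. If so, moving the base point by \<open>e\<close> compensates; one query per
  pair undoes the projection.\<close>

lemma decides_of_restrictions:
  assumes "triangular L" "\<And>a. a \<in> G \<Longrightarrow> decides d (\<lambda>x. f (a \<oplus> proj L x))" "a \<in> G"
  shows "decides (d + length L) (\<lambda>x. f (a \<oplus> x))"
  using assms
proof (induction L arbitrary: d a rule: triangular.induct)
  case (2 u e L)
  then have t: "triangular L" "u \<in> G" "e \<in> G" by auto
  have "decides (Suc d) (\<lambda>x. f (b \<oplus> proj L x))" if b: "b \<in> G" for b
  proof (rule decides.query)
    show "dual_proj L u \<in> G" using t by simp
    show "decides d (\<lambda>x. f (b \<oplus> proj ((u, e) # L) x))" using 2(3) b by blast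
    show "decides d (\<lambda>x. f (b \<oplus> e \<oplus> proj ((u, e) # L) x))" by (rule 2(3)[OF add_closed[OF b t(3)]])
    fix x assume x: "x \<in> G"
    then have "b \<oplus> e \<oplus> (proj L x \<oplus> e) = b \<oplus> proj L x" using t b by (simp add: g_ac)
    then show "f (b \<oplus> proj L x) = (if chi (dual_proj L u) x = 1
        then f (b \<oplus> proj ((u, e) # L) x) else f (b \<oplus> e \<oplus> proj ((u, e) # L) x))"
      using t x by (simp add: chi_proj[symmetric])
  qed
  from 2(1)[OF t(1) this 2(4)] show ?case by simp
qed simp

section \<open>Fourier spectrum under restriction to cosets\<close>

definition spectrum :: "('a \<Rightarrow> real) \<Rightarrow> 'a set" where
  "spectrum f = {u \<in> G. fourier f u \<noteq> 0}"

lemma fourier_restriction: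
  assumes L: "triangular L" and a: "a \<in> G" and d: "d \<in> G"
  shows "fourier (\<lambda>x. f (a \<oplus> proj L x)) d
    = (\<Sum>u | u \<in> G \<and> dual_proj L u = d. fourier f u * chi u a)"
proof (rule fourier_unique[OF d])
  fix x assume x: "x \<in> G"
  have "f (a \<oplus> proj L x) = (\<Sum>u\<in>G. fourier f u * chi u (a \<oplus> proj L x))"
    using L a x by (intro fourier_inversion) auto
  also have "\<dots> = (\<Sum>u\<in>G. fourier f u * chi u a * chi (dual_proj L u) x)"
    using L a x by (simp add: chi_add chi_proj mult_ac)
  also have "\<dots> = (\<Sum>d\<in>G. \<Sum>u | u \<in> G \<and> dual_proj L u = d. fourier f u * chi u a * chi (dual_proj L u) x)"
    using L by (intro sum.group[symmetric]) auto
  also have "\<dots> = (\<Sum>d\<in>G. (\<Sum>u | u \<in> G \<and> dual_proj L u = d. fourier f u * chi u a) * chi d x)"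
    by (intro sum.cong refl) (simp add: sum_distrib_right)
  finally show "f (a \<oplus> proj L x)
    = (\<Sum>d\<in>G. (\<Sum>u | u \<in> G \<and> dual_proj L u = d. fourier f u * chi u a) * chi d x)" .
qed

lemma fourier_const:
  assumes "\<And>x. x \<in> G \<Longrightarrow> f x = b" "u \<in> G" "u \<noteq> \<zero>"
  shows "fourier f u = 0"
proof -
  have "(\<Sum>x\<in>G. f x * chi u x) = b * (\<Sum>x\<in>G. chi x u)"
    using assms by (simp add: sum_distrib_left chi_sym)
  then show ?thesis using assms by (simp add: fourier_def sum_chi)
qed

text \<open>Constancy on one coset makes the coefficients over every nonzero \<open>d\<close> cancel, so a nonempty
  fibre of \<open>dual_proj L\<close> in the spectrum has at least two elements.\<close>

lemma spectrum_halves: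
  assumes L: "triangular L" and w: "w \<in> G" and const: "\<And>x. x \<in> G \<Longrightarrow> f (w \<oplus> proj L x) = b"
    and a: "a \<in> G"
  shows "2 * card (spectrum (\<lambda>x. f (a \<oplus> proj L x)) - {\<zero>}) \<le> card (spectrum f - {\<zero>})"
proof -
  define S where "S = spectrum (\<lambda>x. f (a \<oplus> proj L x)) - {\<zero>}"
  define F where "F d = {u \<in> spectrum f. dual_proj L u = d}" for d
  have SG: "S \<subseteq> G" by (auto simp: S_def spectrum_def)
  have fS: "finite S" using SG finite_subset fin by blast
  have ff: "finite (spectrum f)" by (simp add: spectrum_def)
  have coeff: "fourier (\<lambda>x. f (c \<oplus> proj L x)) d = (\<Sum>u\<in>F d. fourier f u * chi u c)"
    if "c \<in> G" "d \<in> G" for c d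
    unfolding fourier_restriction[OF L that]
    by (rule sum.mono_neutral_right) (auto simp: F_def spectrum_def)
  have two: "2 \<le> card (F d)" if d: "d \<in> S" for d
  proof (rule ccontr)
    assume "\<not> 2 \<le> card (F d)"
    then have "card (F d) = 0 \<or> card (F d) = 1" by linarith
    moreover have "finite (F d)" using ff by (simp add: F_def)
    ultimately consider "F d = {}" | u where "F d = {u}" by (auto simp: card_1_singleton_iff)
    then show False
    proof cases
      case 1
      then show False using coeff[OF a, of d] d SG by (auto simp: S_def spectrum_def)
    next
      case (2 u)
      then have u: "u \<in> G" "fourier f u \<noteq> 0" by (auto simp: F_def spectrum_def)
      have "fourier (\<lambda>x. f (w \<oplus> proj L x)) d = 0"
        by (rule fourier_const[OF const]) (use d SG in \<open>auto simp: S_def\<close>)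
      then have "fourier f u * chi u w = 0" using coeff[OF w, of d] 2 d SG by auto
      then show False using u chi_cases[OF u(1) w] by auto
    qed
  qed
  have "2 * card S = (\<Sum>d\<in>S. 2)" by simp
  also have "\<dots> \<le> (\<Sum>d\<in>S. card (F d))" by (rule sum_mono) (rule two)
  also have "\<dots> = card (\<Union>d\<in>S. F d)"
    by (rule card_UN_disjoint[symmetric]) (use fS ff in \<open>auto simp: F_def\<close>)
  \<comment> \<open>\<open>dual_proj L\<close> fixes \<zero> and \<open>S\<close> omits it, so
    \<zero> lies in none of these fibres and can be left out here too.\<close>
  also have "\<dots> \<le> card (spectrum f - {\<zero>})"
    by (rule card_mono) (use ff L in \<open>auto simp: F_def S_def\<close>)
  finally show ?thesis by (simp add: S_def)
qed

text \<open>What is used of a protocol of cost \<open>c\<close>. The affine substitution \<open>a \<oplus> \<phi> x\<close> makes the property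
  stable under restriction to cosets.\<close>

definition rich :: "nat \<Rightarrow> ('a \<Rightarrow> bool) \<Rightarrow> bool" where
  "rich c f \<longleftrightarrow> (\<forall>\<phi> a. a \<in> G \<longrightarrow> (\<forall>x\<in>G. \<phi> x \<in> G) \<longrightarrow>
     (\<forall>x\<in>G. \<forall>y\<in>G. \<phi> (x \<oplus> y) = \<phi> x \<oplus> \<phi> y) \<longrightarrow>
     (\<exists>B w v. B \<subseteq> G \<and> w \<in> G \<and> card G \<le> 2 ^ c * card B \<and>
        (\<forall>x1\<in>B. \<forall>x2\<in>B. \<forall>x3\<in>B. \<forall>x4\<in>B. f (a \<oplus> \<phi> (w \<oplus> (x1 \<oplus> x2 \<oplus> x3 \<oplus> x4))) = v)))"

lemma rich_restriction:
  assumes "rich c f" "triangular L" "b \<in> G"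
  shows "rich c (\<lambda>x. f (b \<oplus> proj L x))"
  unfolding rich_def
proof (intro allI impI)
  fix \<phi> a assume a: "a \<in> G" and \<phi>: "\<forall>x\<in>G. \<phi> x \<in> G" "\<forall>x\<in>G. \<forall>y\<in>G. \<phi> (x \<oplus> y) = \<phi> x \<oplus> \<phi> y"
  have "b \<oplus> proj L a \<in> G" "\<forall>x\<in>G. proj L (\<phi> x) \<in> G"
    "\<forall>x\<in>G. \<forall>y\<in>G. proj L (\<phi> (x \<oplus> y)) = proj L (\<phi> x) \<oplus> proj L (\<phi> y)"
    using assms a \<phi> by (auto simp: proj_add)
  from assms(1)[unfolded rich_def, rule_format, OF this(1), of "\<lambda>x. proj L (\<phi> x)"] this
  obtain B w v where B: "B \<subseteq> G" "w \<in> G" "card G \<le> 2 ^ c * card B"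
    and v: "\<forall>x1\<in>B. \<forall>x2\<in>B. \<forall>x3\<in>B. \<forall>x4\<in>B.
      f (b \<oplus> proj L a \<oplus> proj L (\<phi> (w \<oplus> (x1 \<oplus> x2 \<oplus> x3 \<oplus> x4)))) = v"
    by blast
  have "b \<oplus> proj L (a \<oplus> \<phi> z) = b \<oplus> proj L a \<oplus> proj L (\<phi> z)" if "z \<in> G" for z
    using assms a \<phi> that by (simp add: proj_add g_assoc)
  moreover have "w \<oplus> (x1 \<oplus> x2 \<oplus> x3 \<oplus> x4) \<in> G"
    if "x1 \<in> B" "x2 \<in> B" "x3 \<in> B" "x4 \<in> B" for x1 x2 x3 x4
    using that B by (auto intro!: add_closed)
  ultimately show "\<exists>B w v. B \<subseteq> G \<and> w \<in> G \<and> card G \<le> 2 ^ c * card B \<and>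
        (\<forall>x1\<in>B. \<forall>x2\<in>B. \<forall>x3\<in>B. \<forall>x4\<in>B. f (b \<oplus> proj L (a \<oplus> \<phi> (w \<oplus> (x1 \<oplus> x2 \<oplus> x3 \<oplus> x4)))) = v)"
    using B v by (intro exI[of _ B] exI[of _ w] exI[of _ v]) auto
qed

text \<open>\<open>k\<close> counts the rounds left, while \<open>c\<close> stays fixed under
  restriction. The strict bound makes \<open>k = 0\<close> mean that no nontrivial coefficient
  remains.\<close>

theorem rich_decides:
  assumes "rich c f" "1 \<le> c" "card (spectrum (\<lambda>x. of_bool (f x)) - {\<zero>}) < 2 ^ k"
  shows "decides (k * (2 ^ 24 * c ^ 4)) f"
  using assms(1,3)
proof (induction k arbitrary: f)
  case 0
  have "finite (spectrum (\<lambda>x. of_bool (f x)) - {\<zero>})" by (simp add: spectrum_def)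
  then have s: "spectrum (\<lambda>x. of_bool (f x)) - {\<zero>} = {}" using 0 by simp
  have "f x = f \<zero>" if x: "x \<in> G" for x
  proof -
    have "fourier (\<lambda>x. of_bool (f x)) u * chi u x = fourier (\<lambda>x. of_bool (f x)) u * chi u \<zero>"
      if "u \<in> G" for u
      using s that x by (cases "u = \<zero>") (auto simp: spectrum_def chi_sym[of \<zero>])
    then have "(\<Sum>u\<in>G. fourier (\<lambda>x. of_bool (f x)) u * chi u x)
        = (\<Sum>u\<in>G. fourier (\<lambda>x. of_bool (f x)) u * chi u \<zero>)"
      by (rule sum.cong[OF refl])
    then have "of_bool (f x) = (of_bool (f \<zero>) :: real)"
      using fourier_inversion[OF x, of "\<lambda>x. of_bool (f x)"]
        fourier_inversion[OF zero_closed, of "\<lambda>x. of_bool (f x)"] by metis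
    then show ?thesis by (auto split: if_splits)
  qed
  then show ?case by (rule decides.const)
next
  case (Suc k)
  from Suc.prems(1)[unfolded rich_def, rule_format, OF zero_closed, of "\<lambda>x. x"]
  obtain B w v where B: "B \<subseteq> G" "w \<in> G" "card G \<le> 2 ^ c * card B"
    and v: "\<And>x1 x2 x3 x4. \<lbrakk>x1 \<in> B; x2 \<in> B; x3 \<in> B; x4 \<in> B\<rbrakk> \<Longrightarrow>
      f (\<zero> \<oplus> (w \<oplus> (x1 \<oplus> x2 \<oplus> x3 \<oplus> x4))) = v"
    by auto
  obtain L where L: "triangular L" "length L \<le> 2 ^ 24 * c ^ 4"
    and sums: "\<And>y. y \<in> annihilator L \<Longrightarrow>
      \<exists>x1\<in>B. \<exists>x2\<in>B. \<exists>x3\<in>B. \<exists>x4\<in>B. y = x1 \<oplus> x2 \<oplus> x3 \<oplus> x4"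
    using bogolyubov[OF B(1,3) assms(2)] by blast
  have const: "f (w \<oplus> proj L x) = v" if x: "x \<in> G" for x
    using sums[OF proj_in_annihilator[OF L(1) x]] v B L x by (metis add_closed proj_closed zero_add)
  have "decides (k * (2 ^ 24 * c ^ 4)) (\<lambda>x. f (a \<oplus> proj L x))" if a: "a \<in> G" for a
  proof (rule Suc.IH)
    show "rich c (\<lambda>x. f (a \<oplus> proj L x))" by (rule rich_restriction[OF Suc.prems(1) L(1) a])
    have "2 * card (spectrum (\<lambda>x. of_bool (f (a \<oplus> proj L x))) - {\<zero>})
        \<le> card (spectrum (\<lambda>x. of_bool (f x)) - {\<zero>})"
      by (rule spectrum_halves[of L w "\<lambda>x. of_bool (f x)", OF L(1) B(2) _ a]) (simp add: const)
    then show "card (spectrum (\<lambda>x. of_bool (f (a \<oplus> proj L x))) - {\<zero>}) < 2 ^ k"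
      using Suc.prems(2) by simp
  qed
  from decides_of_restrictions[OF L(1) this zero_closed]
  show ?case by (rule decides_mono) (use L(2) in auto)
qed

text \<open>Characters in the spectrum are eigenvectors of the matrix
  \<open>f (x \<oplus> y)\<close> with nonzero eigenvalue, so they lie in the span of the functions
  \<open>fst p\<close>. More of them than pairs would be linearly dependent, against uniqueness of
  Fourier coefficients.\<close>

lemma card_spectrum_le_rank:
  fixes f :: "'a \<Rightarrow> real"
  assumes rank: "\<And>x y. \<lbrakk>x \<in> G; y \<in> G\<rbrakk> \<Longrightarrow> f (x \<oplus> y) = (\<Sum>p\<leftarrow>ps. fst p x * snd p y)"
  shows "card (spectrum f) \<le> length ps"
proof (rule ccontr)
  assume "\<not> ?thesis"
  then have lt: "card {..<length ps} < card (spectrum f)" by simp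
  have SG: "spectrum f \<subseteq> G" by (auto simp: spectrum_def)
  then have fS: "finite (spectrum f)" using finite_subset fin by blast
  define m where "m j u = fourier (snd (ps ! j)) u / fourier f u" for j u
  obtain v w where w: "w \<in> spectrum f" "v w \<noteq> 0"
    and v: "\<And>j. j < length ps \<Longrightarrow> (\<Sum>u\<in>spectrum f. m j u * v u) = 0"
    using homogeneous_system_solution[OF _ fS lt, of m] by auto
  have expand: "chi u x = (\<Sum>j<length ps. fst (ps ! j) x * m j u)"
    if u: "u \<in> spectrum f" and x: "x \<in> G" for u x
  proof -
    have uG: "u \<in> G" "fourier f u \<noteq> 0" using u by (auto simp: spectrum_def)
    have "(\<Sum>y\<in>G. f (x \<oplus> y) * chi u y) = (\<Sum>y\<in>G. f (x \<oplus> (y \<oplus> x)) * chi u (y \<oplus> x))"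
      using sum_shift[OF x, of "\<lambda>y. f (x \<oplus> y) * chi u y"] by simp
    also have "\<dots> = (\<Sum>y\<in>G. f y * (chi u y * chi u x))"
    proof (rule sum.cong[OF refl])
      fix y assume "y \<in> G"
      moreover from this have "x \<oplus> (y \<oplus> x) = y" using x by (simp add: g_ac)
      ultimately show "f (x \<oplus> (y \<oplus> x)) * chi u (y \<oplus> x) = f y * (chi u y * chi u x)"
        using uG x by (simp add: chi_add)
    qed
    also have "\<dots> = chi u x * (\<Sum>y\<in>G. f y * chi u y)"
      by (simp add: sum_distrib_left mult_ac)
    also have "\<dots> = chi u x * fourier f u * card G"
      using x by (auto simp: fourier_def)
    finally have 1: "chi u x * fourier f u * card G = (\<Sum>y\<in>G. f (x \<oplus> y) * chi u y)" by simp
    also have "\<dots> = (\<Sum>y\<in>G. \<Sum>j<length ps. fst (ps ! j) x * (snd (ps ! j) y * chi u y))"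
      using x by (simp add: rank sum_list_sum_nth sum_distrib_right atLeast0LessThan mult.assoc)
    also have "\<dots> = (\<Sum>j<length ps. fst (ps ! j) x * fourier (snd (ps ! j)) u) * card G"
      using x by (subst sum.swap) (auto simp: fourier_def sum_distrib_left[symmetric] sum_distrib_right intro!: sum.cong)
    finally have "chi u x * fourier f u = (\<Sum>j<length ps. fst (ps ! j) x * fourier (snd (ps ! j)) u)"
      using x by auto
    then have "chi u x = (\<Sum>j<length ps. fst (ps ! j) x * fourier (snd (ps ! j)) u) / fourier f u"
      using uG(2) by (simp add: eq_divide_eq)
    then show ?thesis by (simp add: m_def sum_divide_distrib)
  qed
  define c where "c u = (if u \<in> spectrum f then v u else 0)" for u
  have zero: "0 = (\<Sum>u\<in>G. c u * chi u x)" if x: "x \<in> G" for x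
  proof -
    have "(\<Sum>u\<in>G. c u * chi u x) = (\<Sum>u\<in>spectrum f. v u * chi u x)"
      using SG by (intro sum.mono_neutral_cong_right) (auto simp: c_def)
    also have "\<dots> = (\<Sum>u\<in>spectrum f. \<Sum>j<length ps. fst (ps ! j) x * (m j u * v u))"
      using x by (simp add: expand sum_distrib_left mult_ac)
    also have "\<dots> = (\<Sum>j<length ps. fst (ps ! j) x * (\<Sum>u\<in>spectrum f. m j u * v u))"
      by (subst sum.swap) (simp add: sum_distrib_left)
    finally show ?thesis by (simp add: v)
  qed
  have "fourier (\<lambda>_. 0) w = c w"
    using w SG zero by (intro fourier_unique) auto
  then show False using w by (simp add: c_def fourier_def)
qed

text \<open>Over all \<open>z\<close>, the shifted intersections count each pair from
  \<open>B\<close> and \<open>C\<close> exactly once; some \<open>z\<close> reaches the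
  average.\<close>

lemma exists_large_shifted_inter:
  assumes "B \<subseteq> G" "C \<subseteq> G"
  shows "\<exists>z\<in>G. card B * card C \<le> card G * card {x \<in> B. x \<oplus> z \<in> C}"
proof (rule ccontr)
  assume "\<not> ?thesis"
  then have "(\<Sum>z\<in>G. card G * card {x \<in> B. x \<oplus> z \<in> C}) < (\<Sum>z\<in>G. card B * card C)"
    using zero_closed by (intro sum_strict_mono) (auto simp: not_le simp del: zero_closed)
  moreover have "(\<Sum>z\<in>G. card {x \<in> B. x \<oplus> z \<in> C}) = card B * card C"
  proof -
    have fB: "finite B" using assms finite_subset fin by blast
    have "(\<Sum>z\<in>G. card {x \<in> B. x \<oplus> z \<in> C}) = (\<Sum>z\<in>G. \<Sum>x\<in>B. if x \<oplus> z \<in> C then 1 else 0)"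
      using fB by (simp add: sum.If_cases Int_def)
    also have "\<dots> = (\<Sum>x\<in>B. \<Sum>z\<in>G. if x \<oplus> z \<in> C then 1 else 0)" by (rule sum.swap)
    also have "\<dots> = (\<Sum>x\<in>B. \<Sum>z\<in>G. if z \<in> C then 1 else 0)"
    proof (rule sum.cong[OF refl])
      fix x assume "x \<in> B"
      then have x: "x \<in> G" using assms by auto
      then have "(\<Sum>z\<in>G. if x \<oplus> z \<in> C then 1 else 0) = (\<Sum>z\<in>G. if z \<oplus> x \<in> C then 1 else (0::nat))"
        by (intro sum.cong) (auto simp: g_commute)
      then show "(\<Sum>z\<in>G. if x \<oplus> z \<in> C then 1 else 0) = (\<Sum>z\<in>G. if z \<in> C then 1 else (0::nat))"
        using sum_shift[OF x, of "\<lambda>z. if z \<in> C then 1 else (0::nat)"] by simp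
    qed
    also have "\<dots> = card B * card C"
      using assms(2) by (simp add: sum.If_cases Int_absorb1)
    finally show ?thesis .
  qed
  ultimately show False by (simp add: sum_distrib_left[symmetric])
qed

text \<open>The first side stays in place. Each of the three shifted intersections multiplies the
  density by at least that of the next side, so \<open>D\<close> inherits the density of the whole
  box.\<close>

lemma common_set_of_box:
  assumes "\<And>i. i < 4 \<Longrightarrow> B i \<subseteq> G" "card G ^ 4 \<le> 2 ^ c * (\<Prod>i<(4::nat). card (B i))"
  shows "\<exists>D z1 z2 z3. D \<subseteq> B 0 \<and> z1 \<in> G \<and> z2 \<in> G \<and> z3 \<in> G \<and> card G \<le> 2 ^ c * card D
    \<and> (\<forall>x\<in>D. x \<oplus> z1 \<in> B 1 \<and> x \<oplus> z2 \<in> B 2 \<and> x \<oplus> z3 \<in> B 3)"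
proof -
  have B: "B 0 \<subseteq> G" "B 1 \<subseteq> G" "B 2 \<subseteq> G" "B 3 \<subseteq> G" using assms(1) by auto
  define N where "N = card G"
  obtain z1 where z1: "z1 \<in> G" "card (B 0) * card (B 1) \<le> N * card {x \<in> B 0. x \<oplus> z1 \<in> B 1}"
    using exists_large_shifted_inter[OF B(1,2)] by (auto simp: N_def)
  define D1 where "D1 = {x \<in> B 0. x \<oplus> z1 \<in> B 1}"
  have D1: "D1 \<subseteq> G" using B by (auto simp: D1_def)
  obtain z2 where z2: "z2 \<in> G" "card D1 * card (B 2) \<le> N * card {x \<in> D1. x \<oplus> z2 \<in> B 2}"
    using exists_large_shifted_inter[OF D1 B(3)] by (auto simp: N_def)
  define D2 where "D2 = {x \<in> D1. x \<oplus> z2 \<in> B 2}"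
  have D2: "D2 \<subseteq> G" using D1 by (auto simp: D2_def)
  obtain z3 where z3: "z3 \<in> G" "card D2 * card (B 3) \<le> N * card {x \<in> D2. x \<oplus> z3 \<in> B 3}"
    using exists_large_shifted_inter[OF D2 B(4)] by (auto simp: N_def)
  define D where "D = {x \<in> D2. x \<oplus> z3 \<in> B 3}"
  have "N ^ 4 \<le> 2 ^ c * (card (B 0) * card (B 1) * card (B 2) * card (B 3))"
    using assms(2) by (simp add: N_def numeral_eq_Suc mult_ac)
  also have "\<dots> \<le> 2 ^ c * (N * card D1 * card (B 2) * card (B 3))"
    using z1(2) by (intro mult_le_mono2 mult_le_mono1) (simp add: D1_def)
  also have "\<dots> = 2 ^ c * (N * (card D1 * card (B 2)) * card (B 3))" by (simp add: mult_ac)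
  also have "\<dots> \<le> 2 ^ c * (N * (N * card D2) * card (B 3))"
    using z2(2) by (intro mult_le_mono2 mult_le_mono1) (simp add: D2_def)
  also have "\<dots> = 2 ^ c * (N * N * (card D2 * card (B 3)))" by (simp add: mult_ac)
  also have "\<dots> \<le> 2 ^ c * (N * N * (N * card D))"
    using z3(2) by (intro mult_le_mono2) (simp add: D_def)
  finally have "N ^ 3 * N \<le> N ^ 3 * (2 ^ c * card D)"
    by (simp add: numeral_eq_Suc mult_ac)
  then have "N \<le> 2 ^ c * card D" by (simp add: N_def)
  then show ?thesis using z1(1) z2(1) z3(1)
    by (intro exI[of _ D] exI[of _ z1] exI[of _ z2] exI[of _ z3])
       (auto simp: N_def D_def D2_def D1_def)
qed

end

section \<open>Communication protocols\<close>

text \<open>The maps \<open>\<psi>\<close> allow the box to be measured before a substitution that need not be injective.\<close>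

lemma proto_box:
  fixes \<psi> :: "nat \<Rightarrow> 'b \<Rightarrow> bool list"
  assumes "proto_wf k P" "\<And>i. i < k \<Longrightarrow> finite (A i)"
  shows "\<exists>B v. (\<forall>i<k. B i \<subseteq> A i)
    \<and> (\<Prod>i<k. card (A i)) \<le> 2 ^ proto_cost P * (\<Prod>i<k. card (B i))
    \<and> (\<forall>xs. (\<forall>i<k. xs i \<in> B i) \<longrightarrow> proto_eval P (\<lambda>i. \<psi> i (xs i)) = v)"
  using assms
proof (induction P arbitrary: A)
  case (Out b)
  then show ?case by (intro exI[of _ A] exI[of _ b]) auto
next
  case (Speak i g p0 p1)
  then have i: "i < k" by simp
  define half where "half b = {x \<in> A i. g (\<psi> i x) = b}" for b
  have "card (half True \<union> half False) = card (half True) + card (half False)"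
    using Speak.prems(2)[OF i] by (intro card_Un_disjoint) (auto simp: half_def)
  moreover have "half True \<union> half False = A i" by (auto simp: half_def)
  ultimately have "card (A i) \<le> 2 * card (half True) \<or> card (A i) \<le> 2 * card (half False)" by auto
  then obtain b where b: "card (A i) \<le> 2 * card (half b)" by blast
  define A' where "A' = A(i := half b)"
  define p where "p = (if b then p1 else p0)"
  have fin': "finite (A' j)" if "j < k" for j
    using Speak.prems(2)[OF that] Speak.prems(2)[OF i] by (auto simp: A'_def half_def)
  have "\<exists>B v. (\<forall>i<k. B i \<subseteq> A' i)
    \<and> (\<Prod>i<k. card (A' i)) \<le> 2 ^ proto_cost p * (\<Prod>i<k. card (B i))
    \<and> (\<forall>xs. (\<forall>i<k. xs i \<in> B i) \<longrightarrow> proto_eval p (\<lambda>i. \<psi> i (xs i)) = v)"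
    using Speak.IH Speak.prems(1) fin' by (cases b) (auto simp: p_def)
  then obtain B v where B: "\<forall>i<k. B i \<subseteq> A' i"
    and le: "(\<Prod>i<k. card (A' i)) \<le> 2 ^ proto_cost p * (\<Prod>i<k. card (B i))"
    and v: "\<forall>xs. (\<forall>i<k. xs i \<in> B i) \<longrightarrow> proto_eval p (\<lambda>i. \<psi> i (xs i)) = v" by blast
  have "(\<Prod>j<k. card (A j)) = card (A i) * (\<Prod>j\<in>{..<k} - {i}. card (A j))"
    using i by (intro prod.remove) auto
  also have "\<dots> \<le> 2 * card (half b) * (\<Prod>j\<in>{..<k} - {i}. card (A j))"
    using b by (rule mult_le_mono1)
  also have "\<dots> = 2 * (card (A' i) * (\<Prod>j\<in>{..<k} - {i}. card (A' j)))"
    by (simp add: A'_def)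
  also have "card (A' i) * (\<Prod>j\<in>{..<k} - {i}. card (A' j)) = (\<Prod>j<k. card (A' j))"
    using i by (intro prod.remove[symmetric]) auto
  also have "\<dots> \<le> 2 ^ proto_cost p * (\<Prod>i<k. card (B i))" by (rule le)
  also have "2 * (2 ^ proto_cost p * (\<Prod>i<k. card (B i)))
      \<le> 2 ^ proto_cost (Speak i g p0 p1) * (\<Prod>i<k. card (B i))"
  proof -
    have "(2::nat) ^ Suc (proto_cost p) \<le> 2 ^ proto_cost (Speak i g p0 p1)"
      by (intro power_increasing) (auto simp: p_def)
    then show ?thesis by (metis mult.assoc mult_le_mono1 power_Suc)
  qed
  finally have "(\<Prod>j<k. card (A j)) \<le> 2 ^ proto_cost (Speak i g p0 p1) * (\<Prod>i<k. card (B i))"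
    by simp
  moreover have "\<forall>j<k. B j \<subseteq> A j" using B i by (auto simp: A'_def half_def split: if_splits)
  moreover have "proto_eval (Speak i g p0 p1) (\<lambda>i. \<psi> i (xs i)) = v"
    if "\<forall>i<k. xs i \<in> B i" for xs
  proof -
    have "xs i \<in> B i" "B i \<subseteq> A' i" using that B i by blast+
    then have "xs i \<in> half b" by (auto simp: A'_def)
    then show ?thesis using v that by (auto simp: half_def p_def)
  qed
  ultimately show ?case by blast
qed

text \<open>With all players except 0 and 1 frozen at \<open>z\<close>, each leaf is reached on a
  rectangle, which is a rank-one function of \<open>x\<close> and \<open>y\<close>.\<close>

lemma proto_rank:
  "\<exists>ps :: ((bool list \<Rightarrow> real) \<times> (bool list \<Rightarrow> real)) list. length ps \<le> 2 ^ proto_cost P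
    \<and> (\<forall>x y. of_bool (proto_eval P (\<lambda>i. if i = 0 then x else if i = 1 then y else z))
          = (\<Sum>p\<leftarrow>ps. fst p x * snd p y))"
proof (induction P)
  case (Out b)
  show ?case by (rule exI[of _ "[(\<lambda>_. of_bool b, \<lambda>_. 1)]"]) simp
next
  case (Speak i g p0 p1)
  obtain ps0 where ps0: "length ps0 \<le> 2 ^ proto_cost p0"
    "\<And>x y. of_bool (proto_eval p0 (\<lambda>i. if i = 0 then x else if i = 1 then y else z))
          = (\<Sum>p\<leftarrow>ps0. fst p x * snd p y :: real)" using Speak.IH(1) by blast
  obtain ps1 where ps1: "length ps1 \<le> 2 ^ proto_cost p1"
    "\<And>x y. of_bool (proto_eval p1 (\<lambda>i. if i = 0 then x else if i = 1 then y else z))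
          = (\<Sum>p\<leftarrow>ps1. fst p x * snd p y :: real)" using Speak.IH(2) by blast
  \<comment> \<open>The indicator of taking branch \<open>b\<close>, factored into a part in
    \<open>x\<close> and a part in \<open>y\<close>; the bit of a frozen player is a constant and
    goes into \<open>a\<close>.\<close>
  define a :: "bool \<Rightarrow> bool list \<Rightarrow> real" where
    "a b x = (if i = 0 then of_bool (g x = b) else if i = 1 then 1 else of_bool (g z = b))" for b x
  define d :: "bool \<Rightarrow> bool list \<Rightarrow> real" where
    "d b y = (if i = 1 then of_bool (g y = b) else 1)" for b y
  define ps where "ps = map (\<lambda>p. (\<lambda>x. a False x * fst p x, \<lambda>y. d False y * snd p y)) ps0
     @ map (\<lambda>p. (\<lambda>x. a True x * fst p x, \<lambda>y. d True y * snd p y)) ps1"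
  have "length ps \<le> 2 ^ proto_cost p0 + 2 ^ proto_cost p1" using ps0 ps1 by (simp add: ps_def)
  also have "\<dots> \<le> 2 ^ max (proto_cost p0) (proto_cost p1) + 2 ^ max (proto_cost p0) (proto_cost p1)"
    by (intro add_mono power_increasing) auto
  finally have len: "length ps \<le> 2 ^ proto_cost (Speak i g p0 p1)" by simp
  have "of_bool (proto_eval (Speak i g p0 p1) (\<lambda>i. if i = 0 then x else if i = 1 then y else z))
      = (\<Sum>p\<leftarrow>ps. fst p x * snd p y)" for x y
  proof -
    have "(\<Sum>p\<leftarrow>ps. fst p x * snd p y)
        = a False x * d False y * (\<Sum>p\<leftarrow>ps0. fst p x * snd p y)
          + a True x * d True y * (\<Sum>p\<leftarrow>ps1. fst p x * snd p y)"
      by (simp add: ps_def comp_def sum_list_const_mult[symmetric] mult_ac)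
    then show ?thesis by (auto simp: ps0(2)[symmetric] ps1(2)[symmetric] a_def d_def)
  qed
  then show ?case using len by blast
qed

lemma proto_of_queries:
  assumes "\<forall>q\<in>set qs. fst q < k"
  shows "\<exists>P. proto_wf k P \<and> (\<forall>xs. proto_eval P xs = h (map (\<lambda>q. xs (fst q) ! snd q) qs))"
  using assms
proof (induction qs arbitrary: h)
  case Nil
  then show ?case by (intro exI[of _ "Out (h [])"]) simp
next
  case (Cons q qs)
  have "\<forall>b. \<exists>P. proto_wf k P \<and> (\<forall>xs. proto_eval P xs = h (b # map (\<lambda>q. xs (fst q) ! snd q) qs))"
  proof
    fix b
    show "\<exists>P. proto_wf k P \<and> (\<forall>xs. proto_eval P xs = h (b # map (\<lambda>q. xs (fst q) ! snd q) qs))"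
      using Cons.IH[of "\<lambda>bs. h (b # bs)"] Cons.prems by simp
  qed
  then obtain P where P: "\<And>b. proto_wf k (P b)"
    "\<And>b xs. proto_eval (P b) xs = h (b # map (\<lambda>q. xs (fst q) ! snd q) qs)"
    by metis
  then show ?case
    using Cons.prems
    by (intro exI[of _ "Speak (fst q) (\<lambda>x. x ! snd q) (P False) (P True)"]) auto
qed

text \<open>\<open>CC\<close> is a \<open>LEAST\<close>, so it is meaningful only once some protocol
  exists. Here every player announces all bits, and \<open>h\<close> recovers the value from the
  transcript.\<close>

lemma proto_exists:
  assumes "\<And>xs ys. (\<And>i. i < k \<Longrightarrow> xs i = ys i) \<Longrightarrow> F xs = F ys"
  shows "\<exists>P. proto_computes k n P F"
proof -
  define qs where "qs = List.product [0..<k] [0..<n]"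
  define bits where "bits xs = map (\<lambda>q. xs (fst q) ! snd q) qs" for xs :: "nat \<Rightarrow> bool list"
  define good where "good xs \<longleftrightarrow> (\<forall>i<k. xs i \<in> cube n)" for xs
  define h where "h bs = F (SOME xs. good xs \<and> bits xs = bs)" for bs
  have "F xs = h (bits xs)" if xs: "good xs" for xs
  proof -
    define ys where "ys = (SOME ys. good ys \<and> bits ys = bits xs)"
    have "good ys \<and> bits ys = bits xs" unfolding ys_def by (rule someI[of _ xs]) (simp add: xs)
    then have ys: "good ys" "bits ys = bits xs" by auto
    have "xs i = ys i" if i: "i < k" for i
    proof (rule nth_equalityI)
      show "length (xs i) = length (ys i)" using xs ys i by (simp add: good_def cube_def)
      fix j assume "j < length (xs i)"
      then have "j < n" using xs i by (simp add: good_def cube_def)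
      then have "(i, j) \<in> set qs" using i by (simp add: qs_def)
      then show "xs i ! j = ys i ! j" using ys(2) by (fastforce simp: bits_def)
    qed
    then show ?thesis unfolding h_def ys_def[symmetric] by (rule assms)
  qed
  moreover obtain P where "proto_wf k P" "\<And>xs. proto_eval P xs = h (bits xs)"
    using proto_of_queries[of qs k h] by (auto simp: qs_def bits_def)
  ultimately show ?thesis by (auto simp: proto_computes_def good_def)
qed

section \<open>The cube with bitwise XOR as a self-dual group\<close>

definition cube_chi :: "nat \<Rightarrow> bool list \<Rightarrow> bool list \<Rightarrow> real" where
  "cube_chi n u x = (\<Prod>i<n. if u ! i \<and> x ! i then -1 else 1)"

lemma length_bxor [simp]: "length (bxor x y) = min (length x) (length y)"
  by (simp add: bxor_def)

lemma nth_bxor [simp]: "\<lbrakk>i < length x; i < length y\<rbrakk> \<Longrightarrow> bxor x y ! i = (x ! i \<noteq> y ! i)"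
  by (simp add: bxor_def)

lemma self_dual_2group_cube:
  "self_dual_2group (cube n) bxor (replicate n False) (cube_chi n)"
proof
  show "finite (cube n)"
    using finite_lists_length_eq[of "UNIV :: bool set" n] by (simp add: cube_def)
  show "cube_chi n u x = 1 \<or> cube_chi n u x = -1" for u x
    unfolding cube_chi_def by (induction n) auto
  show "cube_chi n u (bxor x y) = cube_chi n u x * cube_chi n u y"
    if "u \<in> cube n" "x \<in> cube n" "y \<in> cube n" for u x y
    using that unfolding cube_chi_def prod.distrib[symmetric]
    by (intro prod.cong) (auto simp: cube_def)
  show "cube_chi n u x = cube_chi n x u" for u x
    unfolding cube_chi_def by (simp add: conj_commute)
  show "x = replicate n False" if x: "x \<in> cube n" and chi: "\<And>u. u \<in> cube n \<Longrightarrow> cube_chi n u x = 1" for x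
  proof (rule nth_equalityI)
    fix i assume "i < length x"
    then have i: "i < n" using x by (simp add: cube_def)
    have "cube_chi n ((replicate n False)[i := True]) x = (\<Prod>j<n. if j = i then (if x ! i then -1 else 1) else 1)"
      unfolding cube_chi_def by (intro prod.cong) (auto simp: nth_list_update)
    also have "\<dots> = (if x ! i then -1 else 1)" using i by simp
    finally show "x ! i = replicate n False ! i"
      using chi[of "(replicate n False)[i := True]"] i by (auto simp: cube_def split: if_splits)
  qed (use x in \<open>simp add: cube_def\<close>)
qed (auto simp: cube_def intro!: nth_equalityI)

context
  fixes n :: nat
begin

interpretation cube: self_dual_2group "cube n" bxor "replicate n False" "cube_chi n"
  by (rule self_dual_2group_cube)

lemma cube_chi_parity:
  assumes "x \<in> cube n"
  shows "cube_chi n u x = (if parity {i. i < n \<and> u ! i} x then -1 else 1)"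
proof -
  have "cube_chi n u x = (-1) ^ card {i. i < n \<and> u ! i \<and> x ! i}"
    unfolding cube_chi_def by (simp add: prod.If_cases Int_def lessThan_def conj_ac)
  moreover have "{i \<in> {i. i < n \<and> u ! i}. i < length x \<and> x ! i} = {i. i < n \<and> u ! i \<and> x ! i}"
    using assms by (auto simp: cube_def)
  ultimately show ?thesis by (simp add: parity_def minus_one_power_iff)
qed

lemma pdt_of_decides:
  "cube.decides d f \<Longrightarrow> \<exists>T. pdt_computes n T f \<and> pdt_depth T \<le> d"
proof (induction rule: cube.decides.induct)
  case (const f b d)
  then show ?case by (intro exI[of _ "PLeaf b"]) (simp add: pdt_computes_def)
next
  case (query u d f0 f1 f)
  then obtain T0 T1 where "pdt_computes n T0 f0" "pdt_depth T0 \<le> d"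
    "pdt_computes n T1 f1" "pdt_depth T1 \<le> d" by blast
  then show ?case using query.hyps
    by (intro exI[of _ "PNode {i. i < n \<and> u ! i} T0 T1"])
       (auto simp: pdt_computes_def cube_chi_parity)
qed

lemma PDT_le_of_decides: "cube.decides d f \<Longrightarrow> PDT n f \<le> d"
proof -
  assume "cube.decides d f"
  then obtain T where T: "pdt_computes n T f" "pdt_depth T \<le> d" using pdt_of_decides by blast
  have "PDT n f \<le> pdt_depth T" unfolding PDT_def by (rule Least_le) (use T in blast)
  then show ?thesis using T by simp
qed

definition xor4 :: "(nat \<Rightarrow> bool list) \<Rightarrow> bool list" where
  "xor4 xs = bxor (bxor (bxor (xs 0) (xs 1)) (xs 2)) (xs 3)"

text \<open>The substitution is distributed over the players: each applies \<open>\<phi>\<close> to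
  its input and player 0 alone adds \<open>a\<close>. The shifts of the box sides add up to the
  translation \<open>w\<close>.\<close>

lemma rich_of_proto:
  assumes P: "proto_computes 4 n P (\<lambda>xs. f (xor4 xs))"
  shows "cube.rich (proto_cost P) f"
  unfolding cube.rich_def
proof (intro allI impI)
  fix \<phi> a
  assume a: "a \<in> cube n" and \<phi>: "\<forall>x\<in>cube n. \<phi> x \<in> cube n"
    and hom: "\<forall>x\<in>cube n. \<forall>y\<in>cube n. \<phi> (bxor x y) = bxor (\<phi> x) (\<phi> y)"
  define \<psi> where "\<psi> i x = (if i = 0 then bxor a (\<phi> x) else \<phi> x)" for i :: nat and x
  obtain B v where B: "\<forall>i<4. B i \<subseteq> cube n"
    and le: "(\<Prod>i<(4::nat). card (cube n)) \<le> 2 ^ proto_cost P * (\<Prod>i<4. card (B i))"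
    and v: "\<forall>xs. (\<forall>i<4. xs i \<in> B i) \<longrightarrow> proto_eval P (\<lambda>i. \<psi> i (xs i)) = v"
    using proto_box[of 4 P "\<lambda>_. cube n" \<psi>] P by (auto simp: proto_computes_def)
  obtain D z1 z2 z3 where D: "D \<subseteq> B 0" "card (cube n) \<le> 2 ^ proto_cost P * card D"
    and z: "z1 \<in> cube n" "z2 \<in> cube n" "z3 \<in> cube n"
    and sub: "\<forall>x\<in>D. bxor x z1 \<in> B 1 \<and> bxor x z2 \<in> B 2 \<and> bxor x z3 \<in> B 3"
    using cube.common_set_of_box[of B "proto_cost P"] B le by auto
  have DG: "D \<subseteq> cube n" using D(1) B[rule_format, of 0] by simp
  have "f (bxor a (\<phi> (bxor (bxor (bxor z1 z2) z3) (bxor (bxor (bxor x1 x2) x3) x4)))) = v"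
    if x: "x1 \<in> D" "x2 \<in> D" "x3 \<in> D" "x4 \<in> D" for x1 x2 x3 x4
  proof -
    have xG: "x1 \<in> cube n" "x2 \<in> cube n" "x3 \<in> cube n" "x4 \<in> cube n" using x DG by auto
    define xs where "xs i = (if i = 0 then x1 else if i = 1 then bxor x2 z1
      else if i = 2 then bxor x3 z2 else bxor x4 z3)" for i :: nat
    have xs: "xs i \<in> B i" if "i < 4" for i
      using that x D sub by (auto simp: xs_def numeral_eq_Suc less_Suc_eq)
    have "xs i \<in> cube n" if "i < 4" for i using xs[OF that] B that by auto
    then have \<psi>G: "\<psi> i (xs i) \<in> cube n" if "i < 4" for i
      using that a \<phi> by (auto simp: \<psi>_def)
    have "v = proto_eval P (\<lambda>i. \<psi> i (xs i))" using v xs by auto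
    also have "\<dots> = f (xor4 (\<lambda>i. \<psi> i (xs i)))" using P \<psi>G by (simp add: proto_computes_def)
    also have "xor4 (\<lambda>i. \<psi> i (xs i))
        = bxor a (\<phi> (bxor (bxor (bxor x1 (bxor x2 z1)) (bxor x3 z2)) (bxor x4 z3)))"
      using a \<phi> hom xG z by (simp add: xor4_def \<psi>_def xs_def cube.g_assoc)
    also have "bxor (bxor (bxor x1 (bxor x2 z1)) (bxor x3 z2)) (bxor x4 z3)
        = bxor (bxor (bxor z1 z2) z3) (bxor (bxor (bxor x1 x2) x3) x4)"
      using xG z by (simp add: cube.g_ac)
    finally show ?thesis by simp
  qed
  then show "\<exists>B w v. B \<subseteq> cube n \<and> w \<in> cube n \<and> card (cube n) \<le> 2 ^ proto_cost P * card B
      \<and> (\<forall>x1\<in>B. \<forall>x2\<in>B. \<forall>x3\<in>B. \<forall>x4\<in>B.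
        f (bxor a (\<phi> (bxor w (bxor (bxor (bxor x1 x2) x3) x4)))) = v)"
    using DG D z
    by (intro exI[of _ D] exI[of _ "bxor (bxor z1 z2) z3"] exI[of _ v]) (simp add: cube_def)
qed

lemma card_spectrum_of_proto:
  assumes P: "proto_computes 4 n P (\<lambda>xs. f (xor4 xs))"
  shows "card (cube.spectrum (\<lambda>x. of_bool (f x))) \<le> 2 ^ proto_cost P"
proof -
  define z where "z = replicate n False"
  have z: "z \<in> cube n" by (simp add: z_def cube_def)
  obtain ps :: "((bool list \<Rightarrow> real) \<times> (bool list \<Rightarrow> real)) list"
    where len: "length ps \<le> 2 ^ proto_cost P"
    and ps: "\<And>x y. of_bool (proto_eval P (\<lambda>i. if i = 0 then x else if i = 1 then y else z))
          = (\<Sum>p\<leftarrow>ps. fst p x * snd p y)"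
    using proto_rank[of P z] by blast
  have "of_bool (f (bxor x y)) = (\<Sum>p\<leftarrow>ps. fst p x * snd p y)"
    if "x \<in> cube n" "y \<in> cube n" for x y
  proof -
    have "proto_eval P (\<lambda>i. if i = 0 then x else if i = 1 then y else z)
        = f (xor4 (\<lambda>i. if i = 0 then x else if i = 1 then y else z))"
      using P that z by (simp add: proto_computes_def)
    also have "xor4 (\<lambda>i. if i = 0 then x else if i = 1 then y else z) = bxor x y"
      using that by (simp add: xor4_def z_def)
    finally show ?thesis using ps[of x y] by simp
  qed
  then have "card (cube.spectrum (\<lambda>x. of_bool (f x))) \<le> length ps"
    by (rule cube.card_spectrum_le_rank)
  then show ?thesis using len by simp
qed

lemma PDT_le_CC:
  "PDT n f \<le> 2 ^ 25 * CC 4 n (\<lambda>xs. f (xor4 xs)) ^ 5"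
proof -
  define c where "c = CC 4 n (\<lambda>xs. f (xor4 xs))"
  obtain P0 where "proto_computes 4 n P0 (\<lambda>xs. f (xor4 xs))"
    using proto_exists[of 4 "\<lambda>xs. f (xor4 xs)" n] by (auto simp: xor4_def)
  then have "\<exists>P. proto_computes 4 n P (\<lambda>xs. f (xor4 xs)) \<and> proto_cost P = c"
    unfolding c_def CC_def
    by (intro LeastI[of "\<lambda>c. \<exists>P. proto_computes 4 n P _ \<and> proto_cost P = c" "proto_cost P0"]) blast
  then obtain P where P: "proto_computes 4 n P (\<lambda>xs. f (xor4 xs))" "proto_cost P = c"
    by blast
  have "PDT n f \<le> 2 ^ 25 * c ^ 5"
  \<comment> \<open>At cost 0 the claimed bound is 0, so the single leaf must make \<open>f\<close>
    constant; the Bogolyubov step assumes density exponent at least 1.\<close>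
  proof (cases "c = 0")
    case True
    then obtain b where b: "P = Out b" using P(2) by (cases P) auto
    have "f x = b" if x: "x \<in> cube n" for x
    proof -
      define xs where "xs i = (if i = 0 then x else replicate n False)" for i :: nat
      have "\<forall>i<4. xs i \<in> cube n" using x by (simp add: xs_def cube_def)
      then have "f (xor4 xs) = b" using P(1) by (simp add: b proto_computes_def)
      then show ?thesis using x by (simp add: xor4_def xs_def)
    qed
    then have "cube.decides 0 f" by (rule cube.decides.const)
    then show ?thesis using PDT_le_of_decides by fastforce
  next
    case False
    have "card (cube.spectrum (\<lambda>x. of_bool (f x)) - {replicate n False}) \<le> 2 ^ c"
      by (rule order_trans[OF card_Diff1_le]) (use card_spectrum_of_proto[OF P(1)] P(2) in simp)
    also have "(2::nat) ^ c < 2 ^ (c + 1)" by simp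
    finally have "cube.decides ((c + 1) * (2 ^ 24 * c ^ 4)) f"
      using rich_of_proto[OF P(1)] P(2) False by (intro cube.rich_decides) auto
    then have "PDT n f \<le> (c + 1) * (2 ^ 24 * c ^ 4)" by (rule PDT_le_of_decides)
    also have "\<dots> \<le> (2 * c) * (2 ^ 24 * c ^ 4)" using False by (intro mult_le_mono1) simp
    also have "\<dots> = 2 ^ 25 * (c * c ^ 4)" by simp
    also have "c * c ^ 4 = c ^ 5" by (simp flip: power_Suc)
    finally show ?thesis .
  qed
  then show ?thesis by (simp add: c_def)
qed

end

theorem theorem1p4:
  shows "\<exists>C::real. C > 0 \<and>
    (\<forall>n::nat. \<forall>f :: bool list \<Rightarrow> bool. n \<ge> 1 \<longrightarrow>
       real (PDT n f) \<le>
       C * real (CC 4 n (\<lambda>xs. f (bxor (bxor (bxor (xs 0) (xs 1)) (xs 2)) (xs 3)))) ^ 5)"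
proof (intro exI[of _ "2 ^ 25"] conjI allI impI)
  fix n :: nat and f :: "bool list \<Rightarrow> bool"
  show "real (PDT n f) \<le> 2 ^ 25
      * real (CC 4 n (\<lambda>xs. f (bxor (bxor (bxor (xs 0) (xs 1)) (xs 2)) (xs 3)))) ^ 5"
    using of_nat_mono[OF PDT_le_CC[of n f], where 'a = real] by (simp add: xor4_def)
qed simp

end
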